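(* Let $A$ be an admissible set of addition chains and $k\ge0$ an integer. Then: (1) if $0\le k\le2$, then $f^A(k)=f^A_{st}(k)=k$; (2) if $3\le k\le7$, then $2<f^A(k)\le f^A_{st}(k)\le k$; (3) if $8\le k\le33$, then $3<f^A(k)\le f^A_{st}(k)\le k$; (4) if $k\ge34$, then $\log_2(k+1)-C_s<f^A(k)\le f^A_{st}(k)\le k$, where $C_s=\frac23+\frac23\log_2 3-\frac{1}{\log 2}-\log_2\log\frac43+\sum_{j=0}^\infty\log_2\bigl(1+2^{-6\cdot 2^j+1}\bigr)$.
   Context: An addition chain for a positive integer $n$ is a sequence $(a_0,\ldots,a_r)$ with $a_0=1$, $a_r=n$, and for every $1\le k\le r$ there exist $0\le i,j<k$ with $a_k=a_i+a_j$; $r$ is its length. For a set $A$ of addition chains, $\ell^A(n)$ is the least length of an addition chain for $n$ belonging to $A$. $\nu_2(n)$ is the number of $1$'s in the binary expansion of $n$. $A$ is admissible if (i) for every $n\ge1$, $\ell^A(n)$ is defined and $\ell^A(n)\le\lfloor\log_2 n\rfloor+\nu_2(n)-1$, and (ii) for every $n\ge1$, $\ell^A(2n)\le\ell^A(n)+1$. The $A$-defect is $\delta^A(n)=\ell^A(n)-\log_2 n$, and $\mathscr{D}^A=\{\delta^A(n):n\ge1\}$; a positive integer $m$ is $A$-stable if $\ell^A(2^k m)=\ell^A(m)+k$ for all $k\ge0$, and $\mathscr{D}^A_{st}$ is the set of $\delta^A(m)$ with $m$ $A$-stable. These sets are well-ordered of order type $\omega^\omega$. For $k\ge1$, $f^A(k)$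 is the supremum of the set of the first $\omega^k$ elements of $\mathscr{D}^A$ (in its well-order), and $f^A(0)$ is the least element of $\mathscr{D}^A$; $f^A_{st}(k)$ is defined in the same way with $\mathscr{D}^A_{st}$ in place of $\mathscr{D}^A$. Here $\log$ is the natural logarithm. *)

theory Defs
  imports "HOL-Analysis.Analysis"
begin

section \<open>Addition chains\<close>

text \<open>A chain $(a_0,\ldots,a_r)$ is the list $[a_0,\ldots,a_r]$, so its length as a chain is
  one less than its length as a list.\<close>

definition addition_chain_for :: "nat \<Rightarrow> nat list \<Rightarrow> bool" where
  "addition_chain_for n as \<longleftrightarrow>
     n > 0 \<and> as \<noteq> [] \<and> as ! 0 = 1 \<and> last as = n \<and>
     (\<forall>k. 1 \<le> k \<and> k < length as \<longrightarrow> (\<exists>i<k. \<exists>j<k. as ! k = as ! i + as ! j))"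

definition addition_chains :: "nat list set" where
  "addition_chains = {as. \<exists>n. addition_chain_for n as}"

definition chain_length :: "nat list \<Rightarrow> nat" where
  "chain_length as = length as - 1"

definition ell_defined :: "nat list set \<Rightarrow> nat \<Rightarrow> bool" where
  "ell_defined A n \<longleftrightarrow> (\<exists>as\<in>A. addition_chain_for n as)"

text \<open>Only meaningful when \<^term>\<open>ell_defined A n\<close> holds.\<close>

definition ell :: "nat list set \<Rightarrow> nat \<Rightarrow> nat" where
  "ell A n = (LEAST r. \<exists>as\<in>A. addition_chain_for n as \<and> chain_length as = r)"

definition nu2 :: "nat \<Rightarrow> nat" where
  "nu2 n = card {i. bit n i}"

definition admissible :: "nat list set \<Rightarrow> bool" where
  "admissible A \<longleftrightarrow>
     A \<subseteq> addition_chains \<and>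
     (\<forall>n\<ge>1. ell_defined A n \<and> int (ell A n) \<le> \<lfloor>log 2 (real n)\<rfloor> + int (nu2 n) - 1) \<and>
     (\<forall>n\<ge>1. ell A (2 * n) \<le> ell A n + 1)"

section \<open>Defects\<close>

definition defect :: "nat list set \<Rightarrow> nat \<Rightarrow> real" where
  "defect A n = real (ell A n) - log 2 (real n)"

definition defects :: "nat list set \<Rightarrow> real set" where
  "defects A = {defect A n |n. n \<ge> 1}"

definition stable :: "nat list set \<Rightarrow> nat \<Rightarrow> bool" where
  "stable A m \<longleftrightarrow> m \<ge> 1 \<and> (\<forall>k. ell A (2 ^ k * m) = ell A m + k)"

definition stable_defects :: "nat list set \<Rightarrow> real set" where
  "stable_defects A = {defect A m |m. stable A m}"

section \<open>The first \<open>\<omega>\<^sup>k\<close> elements of a well-ordered set of reals\<close>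

text \<open>The ordinal \<open>\<omega>\<^sup>k\<close> is represented by the lexicographic (reflexive) well-order on the
  lists of naturals of length \<open>k\<close>; the list $[c_{k-1},\ldots,c_0]$ stands for
  the ordinal $\omega^{k-1} c_{k-1} + \cdots + \omega c_1 + c_0$.\<close>

definition omega_pow :: "nat \<Rightarrow> nat list rel" where
  "omega_pow k = Id_on {xs. length xs = k} \<union> lexn less_than k"

lemma Field_omega_pow: "Field (omega_pow k) = {xs. length xs = k}"
  by (auto simp: omega_pow_def Field_def dest: lexn_length)

lemma Well_order_omega_pow: "Well_order (omega_pow k)"
proof -
  have irr: "(xs, xs) \<notin> lexn less_than k" for xs
    using wf_lexn[OF wf_less_than, of k] by (meson wf_not_refl)
  have strict: "omega_pow k - Id = lexn less_than k"
    using irr by (auto simp: omega_pow_def)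
  have len: "length xs = k \<and> length ys = k" if "(xs, ys) \<in> lexn less_than k" for xs ys
    using that by (rule lexn_length)
  have tr: "trans (lexn less_than k)"
    by (rule lexn_transI) simp
  have "refl_on (Field (omega_pow k)) (omega_pow k)"
    unfolding Field_omega_pow by (auto simp: refl_on_def omega_pow_def dest: len)
  moreover have "trans (omega_pow k)"
    using tr unfolding omega_pow_def by (auto intro!: transI dest: transD)
  moreover have "antisym (omega_pow k)"
    using irr unfolding omega_pow_def by (auto intro!: antisymI dest: transD[OF tr])
  moreover have "total_on (Field (omega_pow k)) (omega_pow k)"
  proof -
    have "(xs, ys) \<in> lexn less_than k \<or> (ys, xs) \<in> lexn less_than k"
      if "length xs = k" "length ys = k" "xs \<noteq> ys" for xs ys
    proof -
      have "(xs, ys) \<in> lenlex less_than \<or> (ys, xs) \<in> lenlex less_than"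
        using total_lenlex[OF total_less_than] that(3) by (simp add: total_on_def)
      then have "(xs, ys) \<in> lex less_than \<or> (ys, xs) \<in> lex less_than"
        using that(1,2) by (simp add: lenlex_conv)
      then obtain n where n: "(xs, ys) \<in> lexn less_than n \<or> (ys, xs) \<in> lexn less_than n"
        by (auto simp: lex_def)
      then have "n = k"
        using that(1,2) lexn_length[of xs ys less_than n] lexn_length[of ys xs less_than n] by auto
      with n show ?thesis by simp
    qed
    then show ?thesis
      unfolding Field_omega_pow total_on_def by (auto simp: omega_pow_def)
  qed
  moreover have "wf (omega_pow k - Id)"
    unfolding strict by (rule wf_lexn) simp
  moreover have "omega_pow k \<subseteq> Field (omega_pow k) \<times> Field (omega_pow k)"
    by (auto simp: Field_def)
  ultimately show ?thesis
    by (simp add: well_order_on_def linear_order_on_def partial_order_on_def preorder_on_def)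
qed

text \<open>An element belongs to the first \<open>\<omega>\<^sup>k\<close> elements iff its position, i.e. the order type of
  the set of its predecessors, is smaller than \<open>\<omega>\<^sup>k\<close>.\<close>

definition first_omega_pow :: "nat \<Rightarrow> real set \<Rightarrow> real set" where
  "first_omega_pow k S =
     {x \<in> S. (relation_of (\<le>) {y \<in> S. y < x}, omega_pow k) \<in> ordLess}"

definition limit_value :: "real set \<Rightarrow> nat \<Rightarrow> real" where
  "limit_value S k = (if k = 0 then (LEAST x. x \<in> S) else Sup (first_omega_pow k S))"

definition chain_f :: "nat list set \<Rightarrow> nat \<Rightarrow> real" where
  "chain_f A k = limit_value (defects A) k"

definition chain_f_st :: "nat list set \<Rightarrow> nat \<Rightarrow> real" where
  "chain_f_st A k = limit_value (stable_defects A) k"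

definition C_s :: real where
  "C_s = 2/3 + 2/3 * log 2 3 - 1 / ln 2 - log 2 (ln (4/3)) +
     (\<Sum>j::nat. log 2 (1 + 2 powr (- 6 * 2 ^ j + 1)))"

end

theory Submission
  imports Defs
begin

text \<open>
  The bounds hold in the sharper form $f^A(k) = f^A_{st}(k) = k$ for every $k$.

  Lower bound. Consider a chain for $n$ of defect at most $c < k$, and call a step that does not
  double the largest element so far a nondoubling step. Nondoubling steps make the chain grow
  strictly slower than doublings, so their number is bounded in terms of $c$. Forgetting the
  doublings, $n$ is a power of two times a value $v(G)$ built up by the steps $v_i + 2^{-G_m} v_j$
  with $m$ running over the nondoubling steps. There are finitely many such recipes, each is
  antitone in the exponents $G_m$, and every step with $G_m$ large hardly increases the largest
  element, so it costs almost a full unit of defect; hence fewer than $k$ of the $G_m$ are large.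
  So the defects up to $c$ lie in a finite union of images of monotone maps on $\mathbb{N}^p$ with
  $p < k$, each of order type at most $\omega^p$, and their order type is below $\omega^k$.

  Upper bound. Sums of $k + 1$ powers of two have defect at most $k$, also after multiplication by a
  power of two that makes them stable. Modulo integers these defects are the numbers $-\log_2 u$
  with $u = 1 + 2^{-b_1} + \cdots + 2^{-b_k}$, which form a set of order type $\omega^k$, and only
  the integer parts $0, \ldots, k$ occur. As $\omega^k$ is additively indecomposable, one integer
  part already yields $\omega^k$ stable defects.
\<close>

section \<open>Sets of reals of order type below \<open>\<omega>\<^sup>k\<close>\<close>

text \<open>\<^term>\<open>T\<close> contains a copy of \<open>\<omega>\<^sup>k\<close>, not necessarily as an initial segment.\<close>

primrec contains_omega_pow :: "nat \<Rightarrow> real set \<Rightarrow> bool" where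
  "contains_omega_pow 0 T \<longleftrightarrow> T \<noteq> {}"
| "contains_omega_pow (Suc k) T \<longleftrightarrow>
     (\<exists>U :: nat \<Rightarrow> real set. (\<forall>m. U m \<subseteq> T \<and> contains_omega_pow k (U m)) \<and>
        (\<forall>m m'. m < m' \<longrightarrow> (\<forall>x\<in>U m. \<forall>y\<in>U m'. x < y)))"

lemma contains_omega_pow_SucE:
  assumes "contains_omega_pow (Suc k) T"
  obtains U :: "nat \<Rightarrow> real set" where "\<And>m. U m \<subseteq> T" "\<And>m. contains_omega_pow k (U m)"
    "\<And>m m' x y. m < m' \<Longrightarrow> x \<in> U m \<Longrightarrow> y \<in> U m' \<Longrightarrow> x < y"
  using assms unfolding contains_omega_pow.simps by metis

lemma contains_omega_pow_mono:
  assumes "contains_omega_pow k T" "T \<subseteq> T'"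
  shows "contains_omega_pow k T'"
proof (cases k)
  case 0
  then show ?thesis
    using assms by auto
next
  case (Suc j)
  then obtain U :: "nat \<Rightarrow> real set"
    where "\<And>m. U m \<subseteq> T" "\<And>m. contains_omega_pow j (U m)"
      and less: "\<And>m m' x y. m < m' \<Longrightarrow> x \<in> U m \<Longrightarrow> y \<in> U m' \<Longrightarrow> x < y"
    using assms(1) contains_omega_pow_SucE[of j T] by metis
  then show ?thesis
    unfolding Suc contains_omega_pow.simps using assms(2) less
    by (intro exI[of _ U]) (meson subset_trans)
qed

lemma contains_omega_pow_nonempty: "contains_omega_pow k T \<Longrightarrow> T \<noteq> {}"
proof (induction k arbitrary: T)
  case (Suc k)
  then obtain U :: "nat \<Rightarrow> real set" where "U 0 \<subseteq> T" "contains_omega_pow k (U 0)"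
    by auto
  with Suc.IH show ?case
    by blast
qed simp

text \<open>Two successive blocks are nonempty and would share the only point. This later allows the
  endpoint \<open>k\<close> itself to be discarded.\<close>

lemma not_contains_omega_pow_Suc_singleton: "\<not> contains_omega_pow (Suc k) {x}"
proof
  assume "contains_omega_pow (Suc k) {x}"
  then obtain U :: "nat \<Rightarrow> real set" where U: "\<And>m. U m \<subseteq> {x}" "\<And>m. contains_omega_pow k (U m)"
    and less: "\<And>m m' x y. m < m' \<Longrightarrow> x \<in> U m \<Longrightarrow> y \<in> U m' \<Longrightarrow> x < y"
    by (rule contains_omega_pow_SucE) blast
  have "U m = {x}" for m
    using U[of m] contains_omega_pow_nonempty by blast
  then show False
    using less[of 0 1 x x] by simp
qed

text \<open>Additive indecomposability of \<open>\<omega>\<^sup>k\<close>. By induction every block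
  leaves a copy of the lower power in \<open>S\<close> or in \<open>T\<close>, and by the pigeonhole
  principle one of the two receives infinitely many blocks.\<close>

lemma contains_omega_pow_Un:
  "contains_omega_pow k (S \<union> T) \<Longrightarrow> contains_omega_pow k S \<or> contains_omega_pow k T"
proof (induction k arbitrary: S T)
  case (Suc k)
  from Suc.prems obtain U :: "nat \<Rightarrow> real set"
    where U: "\<And>m. U m \<subseteq> S \<union> T" "\<And>m. contains_omega_pow k (U m)"
      and less: "\<And>m m' x y. m < m' \<Longrightarrow> x \<in> U m \<Longrightarrow> y \<in> U m' \<Longrightarrow> x < y"
    by (rule contains_omega_pow_SucE) blast
  have split: "contains_omega_pow k (U m \<inter> S) \<or> contains_omega_pow k (U m \<inter> T)" for m
  proof (rule Suc.IH)
    have "U m \<inter> S \<union> U m \<inter> T = U m"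
      using U(1)[of m] by blast
    then show "contains_omega_pow k (U m \<inter> S \<union> U m \<inter> T)"
      using U(2) by simp
  qed
  \<comment> \<open>Enumerating the good indices increasingly keeps the blocks in order.\<close>
  have step: "contains_omega_pow (Suc k) R" if inf: "infinite {m. contains_omega_pow k (U m \<inter> R)}" for R
  proof -
    let ?e = "enumerate {m. contains_omega_pow k (U m \<inter> R)}"
    have "contains_omega_pow k (U (?e m) \<inter> R)" for m
      using enumerate_in_set[OF inf, of m] by simp
    moreover have "?e m < ?e m'" if "m < m'" for m m'
      using enumerate_mono[OF that inf] .
    ultimately show ?thesis
      unfolding contains_omega_pow.simps using less
      by (intro exI[of _ "\<lambda>m. U (?e m) \<inter> R"]) blast
  qed
  have "{m. contains_omega_pow k (U m \<inter> S)} \<union> {m. contains_omega_pow k (U m \<inter> T)} = UNIV"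
    using split by blast
  then have "infinite ({m. contains_omega_pow k (U m \<inter> S)} \<union> {m. contains_omega_pow k (U m \<inter> T)})"
    by simp
  then show ?case
    using step[of S] step[of T] by (meson finite_UnI)
qed auto

lemma contains_omega_pow_UN:
  assumes "finite I" "contains_omega_pow k (\<Union>i\<in>I. T i)"
  shows "\<exists>i\<in>I. contains_omega_pow k (T i)"
  using assms
proof (induction I rule: finite_induct)
  case empty
  then show ?case
    using contains_omega_pow_nonempty by fastforce
next
  case (insert i I)
  then show ?case
    using contains_omega_pow_Un[of k "T i" "\<Union>i\<in>I. T i"] by auto
qed

lemma contains_omega_pow_translate:
  "contains_omega_pow k T \<Longrightarrow> contains_omega_pow k ((\<lambda>x. c + x) ` T)"
proof (induction k arbitrary: T)
  case (Suc k)
  from Suc.prems obtain U :: "nat \<Rightarrow> real set"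
    where U: "\<And>m. U m \<subseteq> T" "\<And>m. contains_omega_pow k (U m)"
      and less: "\<And>m m' x y. m < m' \<Longrightarrow> x \<in> U m \<Longrightarrow> y \<in> U m' \<Longrightarrow> x < y"
    by (rule contains_omega_pow_SucE) blast
  show ?case
    unfolding contains_omega_pow.simps
  proof (intro exI[of _ "\<lambda>m. (\<lambda>x. c + x) ` U m"] conjI allI impI)
    fix m m' :: nat
    show "(\<lambda>x. c + x) ` U m \<subseteq> (\<lambda>x. c + x) ` T"
      using U(1) by blast
    show "contains_omega_pow k ((\<lambda>x. c + x) ` U m)"
      using Suc.IH U(2) by blast
    show "\<forall>x\<in>(\<lambda>x. c + x) ` U m. \<forall>y\<in>(\<lambda>x. c + x) ` U m'. x < y" if "m < m'"
      using less[OF that] by auto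
  qed
qed auto

section \<open>Copies of \<open>\<omega>\<^sup>k\<close> as increasing maps on lists\<close>

definition strict_mono_omega_pow :: "nat \<Rightarrow> (nat list \<Rightarrow> real) \<Rightarrow> bool" where
  "strict_mono_omega_pow k h \<longleftrightarrow> (\<forall>xs ys. (xs, ys) \<in> lexn less_than k \<longrightarrow> h xs < h ys)"

lemma Cons_in_lexn_Suc:
  "(x # xs, y # ys) \<in> lexn r (Suc n) \<longleftrightarrow>
     length xs = n \<and> length ys = n \<and> ((x, y) \<in> r \<or> x = y \<and> (xs, ys) \<in> lexn r n)"
  by (auto dest: lexn_length intro!: image_eqI[where x = "((x, xs), (y, ys))"])

text \<open>Connects the recursive notion, which suits induction, with the lexicographic order
  behind \<open>omega_pow\<close>: the head of a list selects the block, the tail the place inside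
  it.\<close>

lemma contains_omega_pow_iff:
  "contains_omega_pow k T \<longleftrightarrow>
     (\<exists>h. strict_mono_omega_pow k h \<and> (\<forall>xs. length xs = k \<longrightarrow> h xs \<in> T))"
proof (induction k arbitrary: T)
  case 0
  then show ?case
    by (auto simp: strict_mono_omega_pow_def)
next
  case (Suc k)
  show ?case
  proof
    assume "contains_omega_pow (Suc k) T"
    then obtain U :: "nat \<Rightarrow> real set"
      where U: "\<And>m. U m \<subseteq> T" "\<And>m. contains_omega_pow k (U m)"
        and less: "\<And>m m' x y. m < m' \<Longrightarrow> x \<in> U m \<Longrightarrow> y \<in> U m' \<Longrightarrow> x < y"
      by (rule contains_omega_pow_SucE) blast
    from U(2) have "\<forall>m. \<exists>h. strict_mono_omega_pow k h \<and> (\<forall>xs. length xs = k \<longrightarrow> h xs \<in> U m)"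
      unfolding Suc.IH by blast
    then obtain h where h: "\<And>m. strict_mono_omega_pow k (h m)"
      "\<And>m xs. length xs = k \<Longrightarrow> h m xs \<in> U m"
      by metis
    have "h (hd xs) (tl xs) < h (hd ys) (tl ys)" if "(xs, ys) \<in> lexn less_than (Suc k)" for xs ys
    proof -
      have "length xs = Suc k" "length ys = Suc k"
        using lexn_length[OF that] by auto
      then obtain x xs' y ys' where eq: "xs = x # xs'" "ys = y # ys'"
        by (metis length_Suc_conv)
      with that have "length xs' = k" "length ys' = k"
        "x < y \<or> x = y \<and> (xs', ys') \<in> lexn less_than k"
        by (simp_all only: Cons_in_lexn_Suc) simp
      then show ?thesis
        using h less unfolding eq strict_mono_omega_pow_def by auto
    qed
    moreover have "h (hd xs) (tl xs) \<in> T" if "length xs = Suc k" for xs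
      using h(2)[of "tl xs" "hd xs"] U(1)[of "hd xs"] that by auto
    ultimately show "\<exists>h. strict_mono_omega_pow (Suc k) h \<and> (\<forall>xs. length xs = Suc k \<longrightarrow> h xs \<in> T)"
      unfolding strict_mono_omega_pow_def by (intro exI[of _ "\<lambda>xs. h (hd xs) (tl xs)"]) blast
  next
    assume "\<exists>h. strict_mono_omega_pow (Suc k) h \<and> (\<forall>xs. length xs = Suc k \<longrightarrow> h xs \<in> T)"
    then obtain h where mono: "\<And>xs ys. (xs, ys) \<in> lexn less_than (Suc k) \<Longrightarrow> h xs < h ys"
      and h: "\<And>xs. length xs = Suc k \<Longrightarrow> h xs \<in> T"
      unfolding strict_mono_omega_pow_def by blast
    define U where "U m = {h (m # xs) |xs. length xs = k}" for m
    have "contains_omega_pow k (U m)" for m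
    proof -
      have "h (m # xs) < h (m # ys)" if "(xs, ys) \<in> lexn less_than k" for xs ys
        using mono[of "m # xs" "m # ys"] lexn_length[OF that] that
        unfolding Cons_in_lexn_Suc by simp
      then show ?thesis
        unfolding Suc.IH strict_mono_omega_pow_def U_def
        by (intro exI[of _ "\<lambda>xs. h (m # xs)"]) blast
    qed
    moreover have "U m \<subseteq> T" for m
      using h by (auto simp: U_def)
    moreover have "x < y" if "m < m'" "x \<in> U m" "y \<in> U m'" for m m' x y
    proof -
      obtain xs ys where "x = h (m # xs)" "y = h (m' # ys)" "length xs = k" "length ys = k"
        using \<open>x \<in> U m\<close> \<open>y \<in> U m'\<close> unfolding U_def by blast
      then show ?thesis
        using mono[of "m # xs" "m' # ys"] \<open>m < m'\<close> unfolding Cons_in_lexn_Suc by simp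
    qed
    ultimately show "contains_omega_pow (Suc k) T"
      unfolding contains_omega_pow.simps by (intro exI[of _ U]) blast
  qed
qed

section \<open>Well-ordered sets of reals and their comparison with
  \<open>\<omega>\<^sup>k\<close>\<close>

definition has_minima :: "real set \<Rightarrow> bool" where
  "has_minima T \<longleftrightarrow> (\<forall>X\<subseteq>T. X \<noteq> {} \<longrightarrow> (\<exists>m\<in>X. \<forall>x\<in>X. m \<le> x))"

lemma Field_relation_of_le: "Field (relation_of (\<le>) (T :: real set)) = T"
  by (auto simp: relation_of_def Field_def)

lemma Well_order_relation_of_le:
  assumes "has_minima T"
  shows "Well_order (relation_of (\<le>) T)"
proof -
  let ?r = "relation_of (\<le>) T"
  have "wf (?r - Id)"
    unfolding wf_eq_minimal
  proof (intro allI impI)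
    fix Q and x :: real
    assume "x \<in> Q"
    show "\<exists>z\<in>Q. \<forall>y. (y, z) \<in> ?r - Id \<longrightarrow> y \<notin> Q"
    proof (cases "Q \<inter> T = {}")
      case True
      then show ?thesis
        using \<open>x \<in> Q\<close> by (auto simp: relation_of_def)
    next
      case False
      then obtain m where "m \<in> Q \<inter> T" "\<forall>x\<in>Q \<inter> T. m \<le> x"
        using assms[unfolded has_minima_def, rule_format, of "Q \<inter> T"] by blast
      then show ?thesis
        by (intro bexI[of _ m]) (auto simp: relation_of_def intro: antisym)
    qed
  qed
  moreover have "refl_on T ?r" "trans ?r" "antisym ?r" "total_on T ?r"
    by (auto simp: relation_of_def refl_on_def total_on_def intro!: transI antisymI)
  moreover have "?r \<subseteq> T \<times> T"
    by (auto simp: relation_of_def)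
  ultimately show ?thesis
    by (simp add: well_order_on_def linear_order_on_def partial_order_on_def preorder_on_def Field_relation_of_le)
qed

lemma has_minima_if_Well_order:
  assumes "Well_order (relation_of (\<le>) T)"
  shows "has_minima T"
  unfolding has_minima_def
proof (intro allI impI)
  fix X
  assume X: "X \<subseteq> T" "X \<noteq> {}"
  have "wf (relation_of (\<le>) T - Id)"
    using assms by (simp add: well_order_on_def)
  then obtain z where "z \<in> X" "\<forall>y. (y, z) \<in> relation_of (\<le>) T - Id \<longrightarrow> y \<notin> X"
    using X(2) unfolding wf_eq_minimal by blast
  with X(1) show "\<exists>m\<in>X. \<forall>x\<in>X. m \<le> x"
    by (intro bexI[of _ z]) (force simp: relation_of_def)+
qed

lemma embed_less:
  assumes "Well_order r" "embed r r' f" "(x, y) \<in> r" "x \<noteq> y"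
  shows "(f x, f y) \<in> r' \<and> f x \<noteq> f y"
  using embed_inj_on[OF assms(1,2)] embed_compat[OF assms(2)] assms(3,4)
  by (auto simp: compat_def Field_def inj_on_def)

text \<open>If \<open>T\<close> were a proper initial segment of \<open>\<omega>\<^sup>k\<close> and
  also contained a copy of it, composing the two maps would give a strictly increasing self-map of
  \<open>\<omega>\<^sup>k\<close> into a proper initial segment. Conversely, well-orders are
  comparable, so if \<open>T\<close> is not shorter then \<open>\<omega>\<^sup>k\<close> embeds into
  it.\<close>

lemma ordLess_omega_pow_iff:
  "(relation_of (\<le>) T, omega_pow k) \<in> ordLess \<longleftrightarrow> has_minima T \<and> \<not> contains_omega_pow k T"
proof (intro iffI conjI)
  assume less: "(relation_of (\<le>) T, omega_pow k) \<in> ordLess"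
  then have wo: "Well_order (relation_of (\<le>) T)"
    by (auto simp: ordLess_def)
  then show "has_minima T"
    by (rule has_minima_if_Well_order)
  show "\<not> contains_omega_pow k T"
  proof
    assume "contains_omega_pow k T"
    then obtain h where mono: "\<And>xs ys. (xs, ys) \<in> lexn less_than k \<Longrightarrow> h xs < h ys"
      and h: "\<And>xs. length xs = k \<Longrightarrow> h xs \<in> T"
      unfolding contains_omega_pow_iff strict_mono_omega_pow_def by blast
    obtain f where f: "embedS (relation_of (\<le>) T) (omega_pow k) f"
      using less by (auto simp: ordLess_def)
    then have emb: "embed (relation_of (\<le>) T) (omega_pow k) f"
      by (simp add: embedS_def)
    have "f ` T \<subset> {xs. length xs = k}"
      using f embedS_iff[OF wo emb] by (simp add: Field_relation_of_le Field_omega_pow)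
    then have len: "length (f x) = k" if "x \<in> T" for x
      using that by blast
    obtain a where a: "length a = k" "a \<notin> f ` T"
      using \<open>f ` T \<subset> {xs. length xs = k}\<close> by blast
    have fmono: "(f x, f y) \<in> lexn less_than k" if "x \<in> T" "y \<in> T" "x < y" for x y
    proof -
      have "(x, y) \<in> relation_of (\<le>) T"
        using that by (simp add: relation_of_def)
      then have "(f x, f y) \<in> omega_pow k" "f x \<noteq> f y"
        using embed_less[OF wo emb] that(3) by blast+
      then show ?thesis
        by (simp add: omega_pow_def Id_on_iff)
    qed
    have wf: "wf (lexn less_than k)"
      by (rule wf_lexn) simp
    \<comment> \<open>An increasing self-map of a well-order moves no point down: if
      \<open>xs\<close> were moved down, so would be the smaller point
      \<open>f (h xs)\<close>.\<close>
    have nless: "length xs = k \<Longrightarrow> (f (h xs), xs) \<notin> lexn less_than k" for xs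
    proof (induction xs rule: wf_induct_rule[OF wf])
      case (1 xs)
      show ?case
      proof
        assume fh: "(f (h xs), xs) \<in> lexn less_than k"
        have T: "h xs \<in> T"
          using h 1(2) by simp
        then have fT: "length (f (h xs)) = k" "h (f (h xs)) \<in> T"
          using len h by auto
        then have "(f (h (f (h xs))), f (h xs)) \<in> lexn less_than k"
          using fmono[OF _ T mono[OF fh]] by simp
        with 1(1)[OF fh fT(1)] show False
          by simp
      qed
    qed
    have "(a, f (h a)) \<in> omega_pow k"
    proof -
      have "total_on {xs. length xs = k} (omega_pow k)"
        using Well_order_omega_pow[of k]
        by (simp add: well_order_on_def linear_order_on_def Field_omega_pow)
      then have "a = f (h a) \<or> (a, f (h a)) \<in> omega_pow k \<or> (f (h a), a) \<in> omega_pow k"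
        using a(1) len h unfolding total_on_def by blast
      then show ?thesis
        using nless[OF a(1)] a(1) by (auto simp: omega_pow_def)
    qed
    moreover have "wo_rel.ofilter (omega_pow k) (f ` T)"
      using embed_Field_ofilter[OF wo Well_order_omega_pow emb] by (simp add: Field_relation_of_le)
    ultimately have "a \<in> f ` T"
      using h[OF a(1)] unfolding wo_rel.ofilter_def[OF Well_order_omega_pow[folded wo_rel_def]] under_def
      by blast
    with a(2) show False
      by blast
  qed
next
  assume T: "has_minima T \<and> \<not> contains_omega_pow k T"
  then have wo: "Well_order (relation_of (\<le>) T)"
    by (simp add: Well_order_relation_of_le)
  show "(relation_of (\<le>) T, omega_pow k) \<in> ordLess"
  proof (rule ccontr)
    assume "\<not> ?thesis"
    then have "(omega_pow k, relation_of (\<le>) T) \<in> ordLeq"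
      using not_ordLess_iff_ordLeq[OF Well_order_omega_pow wo] by blast
    then obtain h where h: "embed (omega_pow k) (relation_of (\<le>) T) h"
      by (auto simp: ordLeq_def)
    have irr: "(xs, xs) \<notin> lexn less_than k" for xs
      using wf_lexn[OF wf_less_than, of k] by (meson wf_not_refl)
    have "h xs < h ys" if "(xs, ys) \<in> lexn less_than k" for xs ys
    proof -
      have "(xs, ys) \<in> omega_pow k" "xs \<noteq> ys"
        using that irr[of xs] by (auto simp: omega_pow_def)
      then have "(h xs, h ys) \<in> relation_of (\<le>) T \<and> h xs \<noteq> h ys"
        by (rule embed_less[OF Well_order_omega_pow h])
      then show ?thesis
        by (simp add: relation_of_def)
    qed
    moreover have "h xs \<in> T" if "length xs = k" for xs
      using embed_Field[OF h] that by (auto simp: Field_omega_pow Field_relation_of_le)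
    ultimately have "contains_omega_pow k T"
      unfolding contains_omega_pow_iff strict_mono_omega_pow_def by blast
    with T show False
      by blast
  qed
qed

section \<open>Closure properties of order types below \<open>\<omega>\<^sup>k\<close>\<close>

definition type_below_omega_pow :: "nat \<Rightarrow> real set \<Rightarrow> bool" where
  "type_below_omega_pow k T \<longleftrightarrow> has_minima T \<and> \<not> contains_omega_pow k T"

lemma contains_omega_pow_decrease:
  "contains_omega_pow k T \<Longrightarrow> j \<le> k \<Longrightarrow> contains_omega_pow j T"
proof (induction k arbitrary: T)
  case (Suc k)
  then obtain U :: "nat \<Rightarrow> real set" where "U 0 \<subseteq> T" "contains_omega_pow k (U 0)"
    by auto
  then have "contains_omega_pow k T"
    by (rule contains_omega_pow_mono[rotated])
  with Suc show ?case
    by (metis le_Suc_eq)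
qed simp

lemma type_below_omega_pow_increase:
  "type_below_omega_pow j T \<Longrightarrow> j \<le> k \<Longrightarrow> type_below_omega_pow k T"
  unfolding type_below_omega_pow_def using contains_omega_pow_decrease by blast

lemma type_below_omega_pow_subset:
  assumes "type_below_omega_pow k T" "S \<subseteq> T"
  shows "type_below_omega_pow k S"
proof -
  have "has_minima S"
    using assms unfolding type_below_omega_pow_def has_minima_def by (meson subset_trans)
  moreover have "\<not> contains_omega_pow k S"
    using assms contains_omega_pow_mono[of k S T] unfolding type_below_omega_pow_def by blast
  ultimately show ?thesis
    by (simp add: type_below_omega_pow_def)
qed

lemma has_minima_Un:
  assumes "has_minima S" "has_minima T"
  shows "has_minima (S \<union> T)"
  unfolding has_minima_def
proof (intro allI impI)
  fix X
  assume X: "X \<subseteq> S \<union> T" "X \<noteq> {}"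
  have min: "R \<inter> X = {} \<or> (\<exists>m\<in>R \<inter> X. \<forall>x\<in>R \<inter> X. m \<le> x)" if "has_minima R" for R
    using that[unfolded has_minima_def, rule_format, of "R \<inter> X"] by blast
  consider "S \<inter> X = {}" | "T \<inter> X = {}" | m m' where "m \<in> S \<inter> X" "m' \<in> T \<inter> X"
    "\<forall>x\<in>S \<inter> X. m \<le> x" "\<forall>x\<in>T \<inter> X. m' \<le> x"
    using min[OF assms(1)] min[OF assms(2)] by blast
  then show "\<exists>m\<in>X. \<forall>x\<in>X. m \<le> x"
  proof cases
    case 1
    then have "X \<subseteq> T"
      using X(1) by blast
    then show ?thesis
      using X(2) assms(2) unfolding has_minima_def by blast
  next
    case 2
    then have "X \<subseteq> S"
      using X(1) by blast
    then show ?thesis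
      using X(2) assms(1) unfolding has_minima_def by blast
  next
    case 3
    then have "min m m' \<in> X"
      by (simp add: min_def)
    moreover have "min m m' \<le> x" if "x \<in> X" for x
      using that 3(3,4) X(1) by (cases "x \<in> S") (auto simp: min_le_iff_disj)
    ultimately show ?thesis
      by blast
  qed
qed

lemma type_below_omega_pow_UN:
  assumes "finite I" "\<And>i. i \<in> I \<Longrightarrow> type_below_omega_pow k (T i)"
  shows "type_below_omega_pow k (\<Union>i\<in>I. T i)"
proof -
  have "has_minima (\<Union>i\<in>I. T i)"
    using assms
  proof (induction I rule: finite_induct)
    case empty
    then show ?case
      by (simp add: has_minima_def)
  next
    case (insert i I)
    then show ?case
      by (auto simp: type_below_omega_pow_def intro!: has_minima_Un)
  qed
  then show ?thesis
    using assms contains_omega_pow_UN unfolding type_below_omega_pow_def by blast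
qed

text \<open>The first block of a copy of the next power lies entirely below any point of the second
  block, so it would already sit in a proper initial segment. Minima can be sought below any given
  element.\<close>

lemma type_below_omega_pow_SucI:
  assumes "\<And>v. v \<in> T \<Longrightarrow> type_below_omega_pow k {y \<in> T. y < v}"
  shows "type_below_omega_pow (Suc k) T"
  unfolding type_below_omega_pow_def
proof (intro conjI notI)
  show "has_minima T"
    unfolding has_minima_def
  proof (intro allI impI)
    fix X
    assume X: "X \<subseteq> T" "X \<noteq> {}"
    then obtain v where v: "v \<in> X"
      by blast
    show "\<exists>m\<in>X. \<forall>x\<in>X. m \<le> x"
    proof (cases "{y \<in> X. y < v} = {}")
      case True
      then show ?thesis
        using v by (intro bexI[of _ v]) (auto simp: not_less)
    next
      case False
      have "has_minima {y \<in> T. y < v}"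
        using assms v X(1) unfolding type_below_omega_pow_def by blast
      moreover have "{y \<in> X. y < v} \<subseteq> {y \<in> T. y < v}"
        using X(1) by blast
      ultimately obtain m where "m \<in> {y \<in> X. y < v}" "\<forall>x\<in>{y \<in> X. y < v}. m \<le> x"
        using False unfolding has_minima_def by metis
      then show ?thesis
        by (intro bexI[of _ m]) force+
    qed
  qed
next
  assume "contains_omega_pow (Suc k) T"
  then obtain U :: "nat \<Rightarrow> real set"
    where U: "\<And>m. U m \<subseteq> T" "\<And>m. contains_omega_pow k (U m)"
      and less: "\<And>m m' x y. m < m' \<Longrightarrow> x \<in> U m \<Longrightarrow> y \<in> U m' \<Longrightarrow> x < y"
    by (rule contains_omega_pow_SucE) blast
  obtain v where v: "v \<in> U 1"
    using contains_omega_pow_nonempty[OF U(2)] by blast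
  then have "U 0 \<subseteq> {y \<in> T. y < v}"
    using U(1)[of 0] less[of 0 1] by auto
  then have "contains_omega_pow k {y \<in> T. y < v}"
    using contains_omega_pow_mono[OF U(2)] by blast
  then show False
    using assms v U(1)[of 1] unfolding type_below_omega_pow_def by blast
qed

text \<open>No element beyond \<open>k\<close> is among the first \<open>\<omega>\<^sup>k\<close>,
  as a whole copy precedes it. For \<open>c < k\<close>, indecomposability pushes a copy into the
  open interval from \<open>c\<close> to \<open>k\<close>, since neither the part up to
  \<open>c\<close> nor the point \<open>k\<close> can hold one; all points there qualify.\<close>

lemma limit_value_eqI:
  assumes "k \<ge> 1"
    and contains: "contains_omega_pow k (S \<inter> {..real k})"
    and below: "\<And>c. c < real k \<Longrightarrow> type_below_omega_pow k (S \<inter> {..c})"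
  shows "limit_value S k = real k"
proof -
  let ?F = "first_omega_pow k S"
  have F: "?F = {x \<in> S. type_below_omega_pow k {y \<in> S. y < x}}"
    by (simp add: first_omega_pow_def ordLess_omega_pow_iff type_below_omega_pow_def)
  have le: "x \<le> real k" if "x \<in> ?F" for x
  proof (rule ccontr)
    assume "\<not> x \<le> real k"
    then have "S \<inter> {..real k} \<subseteq> {y \<in> S. y < x}"
      by auto
    then have "contains_omega_pow k {y \<in> S. y < x}"
      using contains contains_omega_pow_mono by blast
    with that show False
      by (simp add: F type_below_omega_pow_def)
  qed
  have gt: "\<exists>x\<in>?F. c < x" if "c < real k" for c
  proof -
    let ?I = "S \<inter> {c<..<real k}"
    have "S \<inter> {..real k} \<subseteq> (S \<inter> {..c}) \<union> (?I \<union> {real k})"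
      by auto
    then have "contains_omega_pow k ((S \<inter> {..c}) \<union> (?I \<union> {real k}))"
      by (rule contains_omega_pow_mono[OF contains])
    then have "contains_omega_pow k (S \<inter> {..c}) \<or> contains_omega_pow k ?I \<or>
        contains_omega_pow k {real k}"
      using contains_omega_pow_Un by blast
    then have "contains_omega_pow k ?I"
      using below[OF that] not_contains_omega_pow_Suc_singleton[of "k - 1"] \<open>k \<ge> 1\<close>
      by (auto simp: type_below_omega_pow_def)
    then obtain x where x: "x \<in> S" "c < x" "x < real k"
      using contains_omega_pow_nonempty by (metis IntE ex_in_conv greaterThanLessThan_iff)
    then have "type_below_omega_pow k {y \<in> S. y < x}"
      using type_below_omega_pow_subset[OF below[OF x(3)]] by (simp add: subset_iff)
    with x show ?thesis
      by (auto simp: F)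
  qed
  obtain x where "x \<in> ?F"
    using gt[of "real k - 1"] by auto
  then have "Sup ?F = real k"
    using le gt by (intro cSup_eq_non_empty) (auto, meson leD leI)
  then show ?thesis
    using \<open>k \<ge> 1\<close> by (simp add: limit_value_def)
qed

text \<open>The coordinates in \<open>I\<close> are free. If \<open>\<phi> G < \<phi> H\<close>,
  monotonicity forbids \<open>H \<le> G\<close>, so \<open>G\<close> is smaller than
  \<open>H\<close> in some free coordinate. Hence the values below \<open>\<phi> H\<close> come from
  finitely many boxes with one free coordinate fewer.\<close>

lemma type_below_omega_pow_image_box:
  fixes \<phi> :: "('a \<Rightarrow> nat) \<Rightarrow> real"
  assumes "mono \<phi>" "finite I"
  shows "type_below_omega_pow (Suc (card I)) (\<phi> ` {G. \<forall>i. i \<notin> I \<longrightarrow> G i = c i})"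
  using assms(2)
proof (induction "card I" arbitrary: I c)
  case 0
  then have "\<phi> ` {G. \<forall>i. i \<notin> I \<longrightarrow> G i = c i} = {\<phi> c}"
    by (auto simp: image_iff fun_eq_iff[symmetric])
  moreover have "type_below_omega_pow (Suc 0) {\<phi> c}"
  proof (rule type_below_omega_pow_SucI)
    fix v
    assume "v \<in> {\<phi> c}"
    then have empty: "{y \<in> {\<phi> c}. y < v} = {}"
      by auto
    show "type_below_omega_pow 0 {y \<in> {\<phi> c}. y < v}"
      unfolding empty by (simp add: type_below_omega_pow_def has_minima_def)
  qed
  ultimately show ?case
    unfolding 0(1)[symmetric] by (simp only:)
next
  case (Suc p)
  let ?B = "\<lambda>I c. {G. \<forall>i. i \<notin> I \<longrightarrow> G i = c i}"
  show ?case
  proof (rule type_below_omega_pow_SucI)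
    fix v
    assume "v \<in> \<phi> ` ?B I c"
    then obtain H where H: "H \<in> ?B I c" "v = \<phi> H"
      by blast
    have "{y \<in> \<phi> ` ?B I c. y < v} \<subseteq> (\<Union>i\<in>I. \<Union>d\<in>{..<H i}. \<phi> ` ?B (I - {i}) (c(i := d)))"
    proof
      fix y
      assume "y \<in> {y \<in> \<phi> ` ?B I c. y < v}"
      then obtain G where G: "G \<in> ?B I c" "y = \<phi> G" "\<phi> G < \<phi> H"
        using H(2) by blast
      then have "\<not> H \<le> G"
        using \<open>mono \<phi>\<close> by (metis monoD not_le)
      then obtain i where i: "G i < H i"
        by (auto simp: le_fun_def not_le)
      with G(1) H(1) have "i \<in> I"
        by force
      moreover have "G \<in> ?B (I - {i}) (c(i := G i))"
        using G(1) by auto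
      ultimately show "y \<in> (\<Union>i\<in>I. \<Union>d\<in>{..<H i}. \<phi> ` ?B (I - {i}) (c(i := d)))"
        using i G(2) by blast
    qed
    moreover have "type_below_omega_pow (card I) (\<phi> ` ?B (I - {i}) (c(i := d)))" if "i \<in> I" for i d
      using Suc.hyps(1)[of "I - {i}" "c(i := d)"] Suc.hyps(2) Suc.prems that by simp
    then have "type_below_omega_pow (card I)
        (\<Union>i\<in>I. \<Union>d\<in>{..<H i}. \<phi> ` ?B (I - {i}) (c(i := d)))"
      using Suc.prems by (intro type_below_omega_pow_UN) simp_all
    ultimately show "type_below_omega_pow (card I) {y \<in> \<phi> ` ?B I c. y < v}"
      by (rule type_below_omega_pow_subset[rotated])
  qed
qed

section \<open>Chains with few nondoubling steps\<close>

text \<open>Passing from a chain to its set of elements sorts it and removes repetitions.\<close>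

definition addition_set :: "nat set \<Rightarrow> bool" where
  "addition_set S \<longleftrightarrow> finite S \<and> 1 \<in> S \<and> 0 \<notin> S \<and>
     (\<forall>s\<in>S. s \<noteq> 1 \<longrightarrow> (\<exists>x\<in>S. \<exists>y\<in>S. s = x + y))"

lemma addition_set_of_chain:
  assumes "addition_chain_for n as"
  obtains S where "addition_set S" "Max S = n" "card S \<le> length as"
proof -
  have as: "as \<noteq> []" "as ! 0 = 1" "last as = n" "n > 0"
    and step: "\<And>k. 1 \<le> k \<Longrightarrow> k < length as \<Longrightarrow> \<exists>i<k. \<exists>j<k. as ! k = as ! i + as ! j"
    using assms unfolding addition_chain_for_def by auto
  have pos: "k < length as \<Longrightarrow> as ! k \<ge> 1" for k
  proof (induction k rule: less_induct)
    case (less k)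
    show ?case
    proof (cases "k = 0")
      case False
      then obtain i j where "i < k" "j < k" "as ! k = as ! i + as ! j"
        using step less.prems by (metis One_nat_def Suc_leI neq0_conv)
      then show ?thesis
        using less.IH[of i] less.prems by simp
    qed (simp add: as)
  qed
  \<comment> \<open>A chain need not increase, so entries above its last one may occur. They can be
    cut off, because summands never exceed their sum.\<close>
  let ?S = "set as \<inter> {..n}"
  have "n \<in> ?S"
    using as last_in_set by blast
  have "\<exists>x\<in>?S. \<exists>y\<in>?S. s = x + y" if s: "s \<in> ?S" "s \<noteq> 1" for s
  proof -
    obtain k where k: "k < length as" "as ! k = s"
      using s by (auto simp: in_set_conv_nth)
    then have "1 \<le> k"
      using s(2) as(2) by (cases k) auto
    then obtain i j where ij: "i < k" "j < k" "as ! k = as ! i + as ! j"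
      using step k(1) by blast
    then show ?thesis
      using k s(1) by (intro bexI[of _ "as ! i"] bexI[of _ "as ! j"]) auto
  qed
  moreover have "1 \<in> ?S"
    using as by (metis IntI One_nat_def Suc_leI atMost_iff length_greater_0_conv nth_mem)
  moreover have "0 \<notin> ?S"
    using pos by (force simp: in_set_conv_nth)
  ultimately have "addition_set ?S"
    by (auto simp: addition_set_def)
  moreover have "Max ?S = n"
    using \<open>n \<in> ?S\<close> by (intro Max_eqI) auto
  moreover have "card ?S \<le> length as"
    by (meson List.finite_set card_length card_mono inf_le1 le_trans)
  ultimately show thesis
    by (rule that)
qed

lemma addition_set_remove_Max:
  assumes "addition_set S" "S \<noteq> {1}"
  shows "addition_set (S - {Max S})" and "\<exists>x\<in>S - {Max S}. \<exists>y\<in>S - {Max S}. Max S = x + y"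
proof -
  have S: "finite S" "1 \<in> S" "0 \<notin> S" "\<And>s. s \<in> S \<Longrightarrow> s \<noteq> 1 \<Longrightarrow> \<exists>x\<in>S. \<exists>y\<in>S. s = x + y"
    using assms(1) by (auto simp: addition_set_def)
  have M: "Max S \<in> S"
    using S by (metis Max_in empty_iff)
  obtain z where z: "z \<in> S" "z \<noteq> 1"
    using assms(2) S(2) by blast
  then have "z > 1"
    using S(3) by (metis One_nat_def Suc_lessI neq0_conv)
  then have M1: "Max S \<noteq> 1"
    using Max_ge[OF S(1) z(1)] by simp
  have split: "\<exists>x\<in>S - {Max S}. \<exists>y\<in>S - {Max S}. s = x + y" if s: "s \<in> S" "s \<noteq> 1" for s
  proof -
    obtain x y where xy: "x \<in> S" "y \<in> S" "s = x + y"
      using S(4)[OF s] by blast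
    moreover have "x > 0" "y > 0"
      using S(3) xy by (metis neq0_conv)+
    moreover have "s \<le> Max S"
      using Max_ge[OF S(1) s(1)] .
    ultimately show ?thesis
      by (intro bexI[of _ x] bexI[of _ y]) auto
  qed
  then show "addition_set (S - {Max S})"
    using S M1 by (auto simp: addition_set_def)
  show "\<exists>x\<in>S - {Max S}. \<exists>y\<in>S - {Max S}. Max S = x + y"
    using split M M1 by blast
qed

text \<open>A member of \<^term>\<open>shapes f\<close> records which earlier results each of the \<^term>\<open>f\<close> nondoubling
  steps combines, up to powers of two; the argument \<^term>\<open>G\<close> supplies the ratios of these powers.\<close>

primrec shapes :: "nat \<Rightarrow> ((nat \<Rightarrow> nat) \<Rightarrow> real) list set" where
  "shapes 0 = {[\<lambda>_. 1]}"
| "shapes (Suc f) =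
     (\<lambda>(vs, i, j). vs @ [\<lambda>G. (vs ! i) G + (vs ! j) G / 2 ^ G f]) ` (shapes f \<times> {..f} \<times> {..f})"

lemma shapes_SucE:
  assumes "ws \<in> shapes (Suc f)"
  obtains vs i j where "vs \<in> shapes f" "i \<le> f" "j \<le> f"
    "ws = vs @ [\<lambda>G. (vs ! i) G + (vs ! j) G / 2 ^ G f]"
  using assms by auto

lemma finite_shapes: "finite (shapes f)"
  by (induction f) auto

lemma length_shapes: "vs \<in> shapes f \<Longrightarrow> length vs = Suc f"
  by (induction f arbitrary: vs) auto

lemma shapes_bounds: "vs \<in> shapes f \<Longrightarrow> i \<le> f \<Longrightarrow> 1 \<le> (vs ! i) G \<and> (vs ! i) G \<le> 2 ^ f"
proof (induction f arbitrary: vs i)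
  case (Suc f)
  from Suc.prems(1) obtain us a b where us: "us \<in> shapes f" "a \<le> f" "b \<le> f"
    and vs: "vs = us @ [\<lambda>G. (us ! a) G + (us ! b) G / 2 ^ G f]"
    by (rule shapes_SucE)
  have IH: "1 \<le> (us ! l) G \<and> (us ! l) G \<le> 2 ^ f" if "l \<le> f" for l
    using Suc.IH us(1) that by blast
  show ?case
  proof (cases "i \<le> f")
    case True
    then show ?thesis
      using IH[of i] length_shapes[OF us(1)] by (simp add: vs nth_append)
  next
    case False
    then have i: "i = Suc f"
      using Suc.prems(2) by simp
    have "(us ! b) G / 2 ^ G f \<le> (us ! b) G / 1"
      using IH[OF us(3)] by (intro divide_left_mono) auto
    moreover have "0 \<le> (us ! b) G / 2 ^ G f"
      using IH[OF us(3)] by simp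
    ultimately have "1 \<le> (us ! a) G + (us ! b) G / 2 ^ G f" "(us ! a) G + (us ! b) G / 2 ^ G f \<le> 2 * 2 ^ f"
      using IH[OF us(2), THEN conjunct1] IH[OF us(2), THEN conjunct2] IH[OF us(3), THEN conjunct2]
      by linarith+
    then show ?thesis
      using length_shapes[OF us(1)] by (simp add: vs nth_append i)
  qed
qed simp

text \<open>Only the exponents below \<open>f\<close> enter. Hence \<open>G f\<close> can be chosen
  afresh for the next step, and exponents from \<open>f\<close> on can be set to 0.\<close>

lemma shapes_cong:
  "vs \<in> shapes f \<Longrightarrow> i \<le> f \<Longrightarrow> (\<And>m. m < f \<Longrightarrow> G m = H m) \<Longrightarrow> (vs ! i) G = (vs ! i) H"
proof (induction f arbitrary: vs i)
  case (Suc f)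
  from Suc.prems(1) obtain us a b where us: "us \<in> shapes f" "a \<le> f" "b \<le> f"
    and vs: "vs = us @ [\<lambda>G. (us ! a) G + (us ! b) G / 2 ^ G f]"
    by (rule shapes_SucE)
  have IH: "(us ! l) G = (us ! l) H" if "l \<le> f" for l
    using Suc.IH[OF us(1) that] Suc.prems(3) by simp
  show ?case
  proof (cases "i \<le> f")
    case True
    then show ?thesis
      using IH[of i] length_shapes[OF us(1)] by (simp add: vs nth_append)
  next
    case False
    then have "i = Suc f"
      using Suc.prems(2) by simp
    then show ?thesis
      using IH us(2,3) Suc.prems(3)[of f] length_shapes[OF us(1)] by (simp add: vs nth_append)
  qed
qed simp

text \<open>Larger exponents shrink the second summand. After taking \<open>- log 2\<close> this
  gives the monotone maps needed for boxes.\<close>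

lemma shapes_antimono: "vs \<in> shapes f \<Longrightarrow> i \<le> f \<Longrightarrow> G \<le> H \<Longrightarrow> (vs ! i) H \<le> (vs ! i) G"
proof (induction f arbitrary: vs i)
  case (Suc f)
  from Suc.prems(1) obtain us a b where us: "us \<in> shapes f" "a \<le> f" "b \<le> f"
    and vs: "vs = us @ [\<lambda>G. (us ! a) G + (us ! b) G / 2 ^ G f]"
    by (rule shapes_SucE)
  have IH: "(us ! l) H \<le> (us ! l) G" if "l \<le> f" for l
    using Suc.IH[OF us(1) that] Suc.prems(3) by simp
  show ?case
  proof (cases "i \<le> f")
    case True
    then show ?thesis
      using IH[of i] length_shapes[OF us(1)] by (simp add: vs nth_append)
  next
    case False
    then have i: "i = Suc f"
      using Suc.prems(2) by simp
    have "(2::real) ^ G f \<le> 2 ^ H f"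
      using Suc.prems(3) by (intro power_increasing) (auto simp: le_fun_def)
    then have "(us ! b) H / 2 ^ H f \<le> (us ! b) G / 2 ^ G f"
      using IH[OF us(3)] shapes_bounds[OF us(1,3), of H] by (intro frac_le) auto
    then show ?thesis
      using IH[OF us(2)] length_shapes[OF us(1)] by (simp add: vs nth_append i)
  qed
qed simp

text \<open>The bounds count steps by \<^term>\<open>card S - 1\<close>, whence the factor 2. The growth rate 7/4 of a
  nondoubling step may be any number \<open>b < 2\<close> with \<open>b\<^sup>2 \<ge> b + 1\<close>: such a step is at most the sum of the
  two largest elements, and the fourth condition keeps track of the second largest.\<close>

definition shaped_by ::
  "nat set \<Rightarrow> nat \<Rightarrow> ((nat \<Rightarrow> nat) \<Rightarrow> real) list \<Rightarrow> (nat \<Rightarrow> nat) \<Rightarrow> bool" where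
  "shaped_by S f vs G \<longleftrightarrow> vs \<in> shapes f \<and>
     (\<forall>x\<in>S. \<exists>P. \<exists>i\<le>f. real x = 2 ^ P * (vs ! i) G) \<and>
     2 * real (Max S) * 2 ^ f \<le> 2 ^ card S * (7/4) ^ f \<and>
     (\<forall>x\<in>S. x < Max S \<longrightarrow> 2 * (7/4 * real x) * 2 ^ f \<le> 2 ^ card S * (7/4) ^ f) \<and>
     (\<forall>C K. f + K \<le> C \<longrightarrow> 2 * real (Max S) * 2 ^ card {m. m < f \<and> C \<le> G m} \<le>
        2 ^ card S * (1 + 1 / 2 ^ K) ^ card {m. m < f \<and> C \<le> G m})"

text \<open>A doubling keeps the recipe and doubles both sides of the bounds on the maximum. Any
  other step appends one entry to the recipe and has to gain the factors 7/4 and, if its exponent is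
  large, \<open>1 + 1 / 2 ^ K\<close> in place of 2.\<close>

lemma addition_set_insert_shaped_by:
  assumes S: "addition_set S" "shaped_by S f vs G"
    and s: "x \<in> S" "y \<in> S" "s = x + y" "Max S < s"
  shows "\<exists>f vs G. shaped_by (insert s S) f vs G"
proof -
  have fin: "finite S"
    using S(1) by (simp add: addition_set_def)
  have vs: "vs \<in> shapes f"
    and val: "\<And>x. x \<in> S \<Longrightarrow> \<exists>P. \<exists>i\<le>f. real x = 2 ^ P * (vs ! i) G"
    and bound: "2 * real (Max S) * 2 ^ f \<le> 2 ^ card S * (7/4) ^ f"
    and bound': "\<And>x. x \<in> S \<Longrightarrow> x < Max S \<Longrightarrow> 2 * (7/4 * real x) * 2 ^ f \<le> 2 ^ card S * (7/4) ^ f"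
    and far: "\<And>C K. f + K \<le> C \<Longrightarrow> 2 * real (Max S) * 2 ^ card {m. m < f \<and> C \<le> G m} \<le>
        2 ^ card S * (1 + 1 / 2 ^ K) ^ card {m. m < f \<and> C \<le> G m}"
    using S(2) unfolding shaped_by_def by auto
  have le: "z \<le> Max S" if "z \<in> S" for z
    using fin that by simp
  have "s \<notin> S"
    using le s(4) by force
  then have card: "card (insert s S) = Suc (card S)"
    using fin by simp
  have Max: "Max (insert s S) = s"
  proof (rule Max_eqI)
    show "z \<le> s" if "z \<in> insert s S" for z
      using that le[of z] s(4) by auto
  qed (use fin in auto)
  \<comment> \<open>The common right-hand side of the third and fourth conditions for the old
    set.\<close>
  define R where "R = (2::real) ^ card S * (7/4) ^ f"
  have "R \<ge> 0"
    by (simp add: R_def)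
  have scaled: "2 * (7/4 * real z) * 2 ^ f \<le> 7/4 * R" if "z \<in> S" for z
  proof -
    have "2 * (7/4 * real z) * 2 ^ f \<le> 7/4 * (2 * real (Max S) * 2 ^ f)"
      using le[OF that] by simp
    also have "\<dots> \<le> 7/4 * R"
      using bound by (simp add: R_def)
    finally show ?thesis .
  qed
  show ?thesis
  proof (cases "s = 2 * Max S")
    case True
    have "Max S \<in> S"
      using fin s(1) by (metis Max_in empty_iff)
    then obtain P i where "i \<le> f" "real (Max S) = 2 ^ P * (vs ! i) G"
      using val by blast
    then have "i \<le> f" "real s = 2 ^ Suc P * (vs ! i) G"
      using True by simp_all
    then have "\<forall>x\<in>insert s S. \<exists>P. \<exists>i\<le>f. real x = 2 ^ P * (vs ! i) G"
      using val by blast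
    moreover have "2 * real s * 2 ^ f \<le> 2 * R"
      using bound True by (simp add: R_def)
    moreover have "2 * (7/4 * real z) * 2 ^ f \<le> 2 * R" if "z \<in> S" for z
      using scaled[OF that] \<open>R \<ge> 0\<close> by linarith
    moreover have "2 * real s * 2 ^ card {m. m < f \<and> C \<le> G m} \<le>
        2 * 2 ^ card S * (1 + 1 / 2 ^ K) ^ card {m. m < f \<and> C \<le> G m}" if "f + K \<le> C" for C K
      using far[OF that] True by simp
    ultimately have "shaped_by (insert s S) f vs G"
      using vs unfolding shaped_by_def card Max by (auto simp: R_def)
    then show ?thesis
      by blast
  next
    case False
    \<comment> \<open>The summands are interchanged if necessary so that \<open>P - Q\<close> is a
      genuine difference. The first one need not be the larger number.\<close>
    have "\<exists>x y P Q i j. x \<in> S \<and> y \<in> S \<and> s = x + y \<and> Q \<le> P \<and> i \<le> f \<and> j \<le> f \<and>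
        real x = 2 ^ P * (vs ! i) G \<and> real y = 2 ^ Q * (vs ! j) G"
    proof -
      obtain P i where 1: "i \<le> f" "real x = 2 ^ P * (vs ! i) G"
        using val s(1) by blast
      obtain Q j where 2: "j \<le> f" "real y = 2 ^ Q * (vs ! j) G"
        using val s(2) by blast
      show ?thesis
      proof (cases "Q \<le> P")
        case True
        then show ?thesis
          using 1 2 s by blast
      next
        case False
        then have "P \<le> Q" "s = y + x"
          using s(3) by simp_all
        then show ?thesis
          using 1 2 s(1,2) by blast
      qed
    qed
    then obtain x y P Q i j where xy: "x \<in> S" "y \<in> S" "s = x + y" and QP: "Q \<le> P"
      and ij: "i \<le> f" "j \<le> f"
      and x: "real x = 2 ^ P * (vs ! i) G" and y: "real y = 2 ^ Q * (vs ! j) G"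
      by blast
    define G' where "G' = G(f := P - Q)"
    define ws where "ws = vs @ [\<lambda>G. (vs ! i) G + (vs ! j) G / 2 ^ G f]"
    have ws: "ws \<in> shapes (Suc f)"
      using vs ij unfolding ws_def shapes.simps by (intro image_eqI[of _ _ "(vs, i, j)"]) auto
    have nth: "(ws ! l) G' = (vs ! l) G" if "l \<le> f" for l
      using shapes_cong[OF vs that, of G' G] that length_shapes[OF vs]
      by (simp add: ws_def nth_append G'_def)
    have "real s = 2 ^ P * (ws ! Suc f) G'"
    proof -
      have "(2::real) ^ P = 2 ^ Q * 2 ^ (P - Q)"
        using QP by (simp flip: power_add)
      moreover have "(vs ! i) G' = (vs ! i) G" "(vs ! j) G' = (vs ! j) G"
        using ij by (auto intro!: shapes_cong[OF vs] simp: G'_def)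
      then have "(ws ! Suc f) G' = (vs ! i) G + (vs ! j) G / 2 ^ (P - Q)"
        using length_shapes[OF vs] by (simp add: ws_def nth_append G'_def)
      ultimately show ?thesis
        by (simp add: xy(3) x y distrib_left)
    qed
    then have "\<forall>z\<in>insert s S. \<exists>P. \<exists>i\<le>Suc f. real z = 2 ^ P * (ws ! i) G'"
      using val nth by (metis insert_iff le_Suc_eq order_refl)
    moreover have "2 * real s * 2 ^ Suc f \<le> 2 * (R * (7/4))"
    proof -
      \<comment> \<open>As the step is no doubling of the maximum, one summand \<open>z\<close> is
        strictly smaller. The two old bounds then give \<open>R + 4/7 * R\<close>, which is at most
        \<open>7/4 * R\<close>.\<close>
      obtain z where z: "z \<in> S" "z < Max S" "s \<le> Max S + z"
      proof (cases "x = Max S")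
        case True
        then show ?thesis
          using that[of y] False xy le[OF xy(2)] by simp
      next
        case False
        then show ?thesis
          using that[of x] xy le[OF xy(1)] le[OF xy(2)] by simp
      qed
      then have "real s * 2 ^ f \<le> (real (Max S) + real z) * 2 ^ f"
        by (intro mult_right_mono) auto
      then have "2 * real s * 2 ^ f \<le> 2 * real (Max S) * 2 ^ f + 2 * real z * 2 ^ f"
        by (simp add: algebra_simps)
      moreover have "2 * real (Max S) * 2 ^ f \<le> R" "2 * (7/4 * real z) * 2 ^ f \<le> R"
        using bound bound'[OF z(1,2)] by (simp_all only: R_def)
      ultimately have "2 * real s * 2 ^ f \<le> 7/4 * R"
        using \<open>R \<ge> 0\<close> by linarith
      then show ?thesis
        by simp
    qed
    moreover have "2 * (7/4 * real z) * 2 ^ Suc f \<le> 2 * (R * (7/4))" if "z \<in> S" for z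
      using scaled[OF that] by simp
    moreover have "2 * real s * 2 ^ card {m. m < Suc f \<and> C \<le> G' m} \<le>
        2 * 2 ^ card S * (1 + 1 / 2 ^ K) ^ card {m. m < Suc f \<and> C \<le> G' m}"
      if C: "Suc f + K \<le> C" for C K
    proof -
      let ?T = "{m. m < f \<and> C \<le> G m}"
      have old: "2 * real (Max S) * 2 ^ card ?T \<le> 2 ^ card S * (1 + 1 / 2 ^ K) ^ card ?T"
        using far C by simp
      show ?thesis
      proof (cases "C \<le> P - Q")
        case True
        then have "{m. m < Suc f \<and> C \<le> G' m} = insert f ?T"
          by (auto simp: G'_def)
        then have T': "card {m. m < Suc f \<and> C \<le> G' m} = Suc (card ?T)"
          by simp
        \<comment> \<open>Shape values lie between 1 and \<open>2 ^ f\<close>, and the exponent is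
          at least \<open>f + K\<close>. So \<open>y\<close> is at most \<open>x / 2 ^ K\<close>,
          and the step enlarges the maximum by a factor of at most
          \<open>1 + 1 / 2 ^ K\<close>.\<close>
        have "(vs ! j) G * 2 ^ K \<le> 2 ^ f * 2 ^ K"
          using shapes_bounds[OF vs ij(2)] by simp
        also have "\<dots> = (2::real) ^ (f + K)"
          by (simp add: power_add)
        also have "\<dots> \<le> 2 ^ (P - Q)"
          using C True by (intro power_increasing) auto
        also have "\<dots> \<le> 2 ^ (P - Q) * (vs ! i) G"
          using shapes_bounds[OF vs ij(1)] by simp
        finally have "2 ^ Q * ((vs ! j) G * 2 ^ K) \<le> 2 ^ Q * (2 ^ (P - Q) * (vs ! i) G)"
          by simp
        moreover have "(2::real) ^ P = 2 ^ Q * 2 ^ (P - Q)"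
          using QP by (simp flip: power_add)
        ultimately have "real y * 2 ^ K \<le> real x"
          by (simp add: x y)
        then have "real s \<le> real x * (1 + 1 / 2 ^ K)"
          by (simp add: xy(3) field_simps)
        also have "\<dots> \<le> real (Max S) * (1 + 1 / 2 ^ K)"
          using le[OF xy(1)] by (intro mult_right_mono) auto
        finally have "2 * real s * 2 ^ Suc (card ?T) \<le>
            2 * (real (Max S) * (1 + 1 / 2 ^ K)) * 2 ^ Suc (card ?T)"
          by simp
        also have "\<dots> = 2 * (1 + 1 / 2 ^ K) * (2 * real (Max S) * 2 ^ card ?T)"
          by simp
        also have "\<dots> \<le> 2 * (1 + 1 / 2 ^ K) * (2 ^ card S * (1 + 1 / 2 ^ K) ^ card ?T)"
          using old by (intro mult_left_mono) auto
        also have "\<dots> = 2 * 2 ^ card S * (1 + 1 / 2 ^ K) ^ Suc (card ?T)"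
          by (simp only: power_Suc mult_ac)
        finally show ?thesis
          unfolding T' .
      next
        case False
        then have T': "{m. m < Suc f \<and> C \<le> G' m} = ?T"
          by (auto simp: G'_def less_Suc_eq)
        have "real s \<le> 2 * real (Max S)"
          using le[OF xy(1)] le[OF xy(2)] xy(3) by simp
        then have "2 * real s * 2 ^ card ?T \<le> 2 * (2 * real (Max S) * 2 ^ card ?T)"
          by simp
        also have "\<dots> \<le> 2 * (2 ^ card S * (1 + 1 / 2 ^ K) ^ card ?T)"
          using old by (intro mult_left_mono) auto
        finally show ?thesis
          unfolding T' by (simp only: mult.assoc)
      qed
    qed
    ultimately have "shaped_by (insert s S) (Suc f) ws G'"
      using ws unfolding shaped_by_def card Max by (auto simp: R_def mult_ac)
    then show ?thesis
      by blast
  qed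
qed

lemma addition_set_shaped_by: "addition_set S \<Longrightarrow> \<exists>f vs G. shaped_by S f vs G"
proof (induction "card S" arbitrary: S rule: less_induct)
  case less
  show ?case
  proof (cases "S = {1}")
    case True
    then have "shaped_by S 0 [\<lambda>_. 1] (\<lambda>_. 0)"
      by (auto simp: shaped_by_def intro: exI[of _ 0])
    then show ?thesis
      by blast
  next
    case False
    let ?S = "S - {Max S}"
    have S: "finite S" "1 \<in> S"
      using less.prems by (auto simp: addition_set_def)
    then have M: "Max S \<in> S"
      by (metis Max_in empty_iff)
    have add: "addition_set ?S"
      using addition_set_remove_Max(1)[OF less.prems False] .
    obtain x y where xy: "x \<in> ?S" "y \<in> ?S" "Max S = x + y"
      using addition_set_remove_Max(2)[OF less.prems False] by blast
    have "card ?S < card S"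
      using S(1) M by (rule card_Diff1_less)
    then obtain f vs G where "shaped_by ?S f vs G"
      using less.hyps add by blast
    moreover have "Max ?S < Max S"
    proof -
      have "Max ?S \<in> ?S"
        using xy(1) S(1) by (metis Max_in empty_iff finite_Diff)
      then show ?thesis
        using S(1) by (metis DiffE Max_ge insertI1 le_neq_implies_less)
    qed
    ultimately have "\<exists>f vs G. shaped_by (insert (Max S) ?S) f vs G"
      using addition_set_insert_shaped_by add xy by blast
    then show ?thesis
      using M by (simp add: insert_absorb)
  qed
qed

text \<open>Logarithms of the bounds in \<open>shaped_by\<close> for a shortest chain. The first
  estimate limits the number of nondoubling steps; the second says that steps with large exponents
  cost almost a full unit each.\<close>

lemma defect_shape:
  assumes "ell_defined A n"
  shows "\<exists>f vs G P i. vs \<in> shapes f \<and> i \<le> f \<and> real n = 2 ^ P * (vs ! i) G \<and>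
    real f * log 2 (8/7) \<le> defect A n \<and>
    (\<forall>C K. f + K \<le> C \<longrightarrow>
       real (card {m. m < f \<and> C \<le> G m}) * (1 - log 2 (1 + 1 / 2 ^ K)) \<le> defect A n)"
proof -
  have "\<exists>r. \<exists>as\<in>A. addition_chain_for n as \<and> chain_length as = r"
    using assms by (auto simp: ell_defined_def)
  then have "\<exists>as\<in>A. addition_chain_for n as \<and> chain_length as = ell A n"
    unfolding ell_def by (rule LeastI_ex)
  then obtain as where as: "addition_chain_for n as" "chain_length as = ell A n"
    by blast
  obtain S where S: "addition_set S" "Max S = n" "card S \<le> length as"
    using addition_set_of_chain[OF as(1)] .
  have "n > 0" "length as \<noteq> 0"
    using as(1) by (auto simp: addition_chain_for_def)
  then have card: "card S \<le> Suc (ell A n)"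
    using S(3) as(2) by (simp add: chain_length_def)
  obtain f vs G where sh: "shaped_by S f vs G"
    using addition_set_shaped_by[OF S(1)] by blast
  have "n \<in> S"
    using S(1,2) by (metis Max_in addition_set_def empty_iff)
  then obtain P i where i: "i \<le> f" "real n = 2 ^ P * (vs ! i) G"
    using sh unfolding shaped_by_def by blast
  \<comment> \<open>Replacing the factor 2 by \<open>a\<close> in \<open>t\<close> steps costs
    \<open>1 - log 2 a\<close> of defect per step. This is used with \<open>a\<close> equal to 7/4
    and to \<open>1 + 1 / 2 ^ K\<close>.\<close>
  have log: "real t * (1 - log 2 a) \<le> defect A n"
    if "2 * real n * 2 ^ t \<le> 2 ^ card S * a ^ t" "a > 0" for a t
  proof -
    have "2 * real n * 2 ^ t \<le> 2 ^ Suc (ell A n) * a ^ t"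
      using that power_increasing[OF card, of "2::real"]
      by (meson mult_right_mono one_le_numeral order_trans zero_le_power less_imp_le)
    then have "real n * 2 ^ t \<le> 2 ^ ell A n * a ^ t"
      by simp
    then have "log 2 (real n * 2 ^ t) \<le> log 2 (2 ^ ell A n * a ^ t)"
      using \<open>n > 0\<close> \<open>a > 0\<close> by (subst log_le_cancel_iff) auto
    then show ?thesis
      using \<open>n > 0\<close> \<open>a > 0\<close> by (simp add: log_mult log_nat_power defect_def algebra_simps)
  qed
  have "log 2 (8/7) = 1 - log 2 (7/4 :: real)"
    by (simp add: log_divide log_nat_power[of 2 2 3, simplified] log_nat_power[of 2 2 2, simplified])
  moreover have "real f * (1 - log 2 (7/4)) \<le> defect A n"
    using sh S(2) by (intro log) (auto simp: shaped_by_def)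
  moreover have "real (card {m. m < f \<and> C \<le> G m}) * (1 - log 2 (1 + 1 / 2 ^ K)) \<le> defect A n"
    if "f + K \<le> C" for C K
    using sh S(2) that by (intro log) (auto simp: shaped_by_def intro: add_pos_pos)
  moreover have "vs \<in> shapes f"
    using sh by (simp add: shaped_by_def)
  ultimately show ?thesis
    using i by (intro exI[of _ f] exI[of _ vs] exI[of _ G] exI[of _ P] exI[of _ i]) simp
qed

text \<open>Finitely many recipes, integers and small exponents are possible, and fewer than
  \<open>k\<close> exponents stay free. This covers the defects up to \<open>c\<close> by finitely
  many monotone images of boxes.\<close>

lemma type_below_omega_pow_defects:
  assumes def: "\<And>n. n \<ge> 1 \<Longrightarrow> ell_defined A n"
    and c: "c < real k"
  shows "type_below_omega_pow k (defects A \<inter> {..c})"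
proof -
  \<comment> \<open>\<open>K\<close> is taken so large that \<open>k\<close> steps with large
    exponents would already cost more than \<open>c\<close>.\<close>
  have "(\<lambda>K. real k * (1 - log 2 (1 + (1/2) ^ K))) \<longlonglongrightarrow> real k * (1 - log 2 (1 + 0))"
    by (intro tendsto_intros LIMSEQ_realpow_zero) auto
  then have "\<forall>\<^sub>F K in sequentially. c < real k * (1 - log 2 (1 + (1/2) ^ K))"
    by (rule order_tendstoD) (simp add: c)
  then obtain K where K: "c < real k * (1 - log 2 (1 + 1 / 2 ^ K))"
    by (metis (no_types, lifting) eventually_happens power_one_over trivial_limit_sequentially)
  \<comment> \<open>\<open>F\<close> bounds the number \<open>f\<close> of nondoubling steps, so
    \<open>C\<close> serves all of them at once. \<open>E\<close> bounds the integer
    \<open>e\<close>, which is the defect plus the logarithm of a shape value, the latter being at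
    most \<open>f\<close>.\<close>
  obtain F where F: "c / log 2 (8/7) \<le> real F"
    using real_arch_simple by blast
  define C where "C = F + K"
  define E where "E = nat \<lceil>c\<rceil> + F"
  define Z where "Z = {g. \<forall>m. (m \<in> {..<F} \<longrightarrow> g m \<in> {..<C}) \<and> (m \<notin> {..<F} \<longrightarrow> g m = (0::nat))}"
  define val where "val vs i e G = real e - log 2 ((vs ! i) G)"
    for vs :: "((nat \<Rightarrow> nat) \<Rightarrow> real) list" and i e :: nat and G
  define box where "box I g = {G. \<forall>m. m \<notin> I \<longrightarrow> G m = g m}" for I and g :: "nat \<Rightarrow> nat"
  \<comment> \<open>\<open>I\<close> is the set of large exponents, left free; \<open>g\<close>
    prescribes the others.\<close>
  define Y where "Y = (\<Union>f\<in>{..F}. \<Union>vs\<in>shapes f. \<Union>i\<in>{..f}. \<Union>e\<in>{..E}.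
    \<Union>I\<in>{I. I \<subseteq> {..<f} \<and> card I < k}. \<Union>g\<in>Z. val vs i e ` box I g)"
  have "type_below_omega_pow k Y"
    unfolding Y_def
  proof (intro type_below_omega_pow_UN)
    fix f vs i e I g
    assume vs: "vs \<in> shapes f" "i \<in> {..f}" and I: "I \<in> {I. I \<subseteq> {..<f} \<and> card I < k}"
    have "mono (val vs i e)"
    proof (rule monoI)
      fix G H :: "nat \<Rightarrow> nat"
      assume "G \<le> H"
      then have "(vs ! i) H \<le> (vs ! i) G"
        using shapes_antimono vs by blast
      moreover have "1 \<le> (vs ! i) H"
        using shapes_bounds vs by blast
      ultimately show "val vs i e G \<le> val vs i e H"
        unfolding val_def by (simp add: log_le_cancel_iff)
    qed
    then have "type_below_omega_pow (Suc (card I)) (val vs i e ` box I g)"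
      unfolding box_def using I finite_subset by (intro type_below_omega_pow_image_box) auto
    then show "type_below_omega_pow k (val vs i e ` box I g)"
      using I type_below_omega_pow_increase by auto
  next
    fix f :: nat
    show "finite {I. I \<subseteq> {..<f} \<and> card I < k}"
      by (rule finite_subset[of _ "Pow {..<f}"]) auto
    show "finite Z"
      unfolding Z_def by (rule finite_set_of_finite_funs) auto
  qed (auto simp: finite_shapes)
  moreover have "defects A \<inter> {..c} \<subseteq> Y"
  proof
    fix d
    assume "d \<in> defects A \<inter> {..c}"
    then obtain n where n: "n \<ge> 1" "d = defect A n" "d \<le> c"
      by (auto simp: defects_def)
    obtain f vs G P i where vs: "vs \<in> shapes f" "i \<le> f"
      and val: "real n = 2 ^ P * (vs ! i) G"
      and f: "real f * log 2 (8/7) \<le> d"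
      and far: "\<And>C K. f + K \<le> C \<Longrightarrow>
        real (card {m. m < f \<and> C \<le> G m}) * (1 - log 2 (1 + 1 / 2 ^ K)) \<le> d"
      using defect_shape[OF def[OF n(1)]] n(2) by blast
    have pos: "0 < log 2 (8/7 :: real)"
      by simp
    have "real f \<le> c / log 2 (8/7)"
      using f n(3) by (simp add: pos_le_divide_eq[OF pos])
    then have "f \<le> F"
      using F by simp
    let ?I = "{m. m < f \<and> C \<le> G m}"
    have "card ?I < k"
    proof (rule ccontr)
      assume "\<not> card ?I < k"
      moreover have "1 + 1 / (2::real) ^ K \<le> 2"
        by simp
      then have "0 \<le> 1 - log 2 (1 + 1 / (2::real) ^ K)"
        by (simp add: log_le_one_cancel_iff add_pos_pos)
      ultimately have "real k * (1 - log 2 (1 + 1 / 2 ^ K)) \<le> real (card ?I) * (1 - log 2 (1 + 1 / 2 ^ K))"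
        by (intro mult_right_mono) auto
      then show False
        using far[of K C] \<open>f \<le> F\<close> K n(3) by (simp add: C_def)
    qed
    \<comment> \<open>Zero from \<open>f\<close> on, so that \<open>H\<close> lies in a box over the
      finite set \<open>Z\<close>; the shape value is the same as for \<open>G\<close>.\<close>
    define H where "H = (\<lambda>m. if m < f then G m else 0)"
    define g where "g = (\<lambda>m. if m < f \<and> G m < C then G m else 0)"
    \<comment> \<open>The subtraction does not truncate: \<open>P \<le> ell A n\<close> follows
      below from nonnegativity of \<open>d\<close>.\<close>
    define e where "e = ell A n - P"
    have v: "1 \<le> (vs ! i) G" "(vs ! i) G \<le> 2 ^ f"
      using shapes_bounds[OF vs] by auto
    have logn: "log 2 (real n) = real P + log 2 ((vs ! i) G)"
      using v by (simp add: val log_mult log_nat_power)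
    have logv: "0 \<le> log 2 ((vs ! i) G)"
      using v by simp
    have logv': "log 2 ((vs ! i) G) \<le> real f"
      using v by (subst log_le_iff) (auto simp: powr_realpow)
    have "0 \<le> d"
      using f pos by (meson mult_nonneg_nonneg of_nat_0_le_iff order_trans less_imp_le)
    have "d = real (ell A n) - real P - log 2 ((vs ! i) G)"
      using n(2) logn by (simp add: defect_def)
    moreover from this have "P \<le> ell A n"
      using \<open>0 \<le> d\<close> logv by linarith
    ultimately have d: "d = real e - log 2 ((vs ! i) G)"
      by (simp add: e_def of_nat_diff)
    then have "real e \<le> c + real F"
      using n(3) logv' \<open>f \<le> F\<close> by linarith
    then have "e \<le> E"
      unfolding E_def by linarith
    moreover have "g \<in> Z"
      using \<open>f \<le> F\<close> vs by (auto simp: Z_def g_def C_def)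
    moreover have "d \<in> val vs i e ` box ?I g"
    proof (rule image_eqI)
      show "d = val vs i e H"
        using shapes_cong[OF vs, of H G] by (simp add: d val_def H_def)
      show "H \<in> box ?I g"
        by (auto simp: box_def H_def g_def)
    qed
    moreover have "?I \<in> {I. I \<subseteq> {..<f} \<and> card I < k}"
      using \<open>card ?I < k\<close> by auto
    ultimately show "d \<in> Y"
      unfolding Y_def using \<open>f \<le> F\<close> vs
      by (intro UN_I[of f] UN_I[of vs] UN_I[of i] UN_I[of e] UN_I[of ?I] UN_I[of g]) simp_all
  qed
  ultimately show ?thesis
    by (rule type_below_omega_pow_subset)
qed

section \<open>Stable defects of sparse numbers\<close>

lemma finite_bits_nat: "finite {i. bit (n :: nat) i}"
proof (rule finite_subset)
  show "{i. bit n i} \<subseteq> {..n}"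
  proof
    fix i
    assume "i \<in> {i. bit n i}"
    then have "odd (n div 2 ^ i)"
      by (simp add: bit_iff_odd)
    then have "n div 2 ^ i \<noteq> 0"
      by (metis even_zero)
    then have "2 ^ i \<le> n"
      by (simp add: div_eq_0_iff)
    then show "i \<in> {..n}"
      by (metis atMost_iff le_trans less_exp less_imp_le)
  qed
qed simp

lemma nu2_rec: "nu2 n = of_bool (odd n) + nu2 (n div 2)"
proof -
  have "{i. bit n i} = (if odd n then {0} else {}) \<union> Suc ` {i. bit (n div 2) i}"
  proof (rule set_eqI)
    fix i
    show "i \<in> {i. bit n i} \<longleftrightarrow> i \<in> (if odd n then {0} else {}) \<union> Suc ` {i. bit (n div 2) i}"
      by (cases i) (auto simp: bit_0 bit_Suc)
  qed
  moreover have "card (Suc ` {i. bit (n div 2) i}) = nu2 (n div 2)"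
    by (simp add: nu2_def card_image)
  ultimately show ?thesis
    by (simp add: nu2_def finite_bits_nat)
qed

lemma nu2_0: "nu2 0 = 0"
  by (simp add: nu2_def)

lemma nu2_double: "nu2 (2 * n) = nu2 n"
  by (subst nu2_rec) simp

lemma nu2_double_Suc: "nu2 (Suc (2 * n)) = Suc (nu2 n)"
  by (subst nu2_rec) simp

lemma nu2_1: "nu2 1 = 1"
  using nu2_double_Suc[of 0] by (simp add: nu2_0)

lemma nu2_power2_mult: "nu2 (2 ^ j * n) = nu2 n"
  by (induction j) (simp_all add: nu2_double mult.assoc)

text \<open>The condition on \<open>M / 2\<^sup>Q\<close> says that its binary expansion extends that of \<open>N / 2\<^sup>B\<close>.\<close>

definition sparse_logs :: "nat \<Rightarrow> nat \<Rightarrow> nat \<Rightarrow> real set" where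
  "sparse_logs k N B = {- log 2 (real M / 2 ^ Q) |M Q. nu2 M \<le> nu2 N + k \<and>
     real N / 2 ^ B \<le> real M / 2 ^ Q \<and> real M / 2 ^ Q < (real N + 1) / 2 ^ B}"

text \<open>\<open>N' m\<close> appends \<open>m\<close> zeros and a one to the binary expansion of
  \<open>N\<close>. The intervals of numbers extending these expansions are disjoint and move down
  as \<open>m\<close> grows, so their negated logarithms form the increasing blocks; each block uses
  up one binary one.\<close>

lemma contains_omega_pow_sparse_logs: "N \<ge> 1 \<Longrightarrow> contains_omega_pow k (sparse_logs k N B)"
proof (induction k arbitrary: N B)
  case 0
  have "- log 2 (real N / 2 ^ B) \<in> sparse_logs 0 N B"
    unfolding sparse_logs_def
    by (rule CollectI, rule exI[of _ N], rule exI[of _ B]) (simp add: divide_strict_right_mono)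
  then show ?case
    by auto
next
  case (Suc k)
  define N' where "N' m = Suc (2 * (2 ^ m * N))" for m
  have nu2: "nu2 (N' m) = Suc (nu2 N)" for m
    by (simp add: N'_def nu2_double_Suc nu2_power2_mult)
  have N': "real (N' m) / 2 ^ Suc (B + m) = real N / 2 ^ B + 1 / 2 ^ Suc (B + m)"
    "(real (N' m) + 1) / 2 ^ Suc (B + m) = real N / 2 ^ B + 1 / 2 ^ (B + m)" for m
    by (simp_all add: N'_def field_simps power_add)
  have small: "1 / 2 ^ (B + m) \<le> 1 / (2::real) ^ B" for m
    by (intro divide_left_mono power_increasing) auto
  define U where "U m = sparse_logs k (N' m) (Suc (B + m))" for m
  have mem: "\<exists>M Q. z = - log 2 (real M / 2 ^ Q) \<and> nu2 M \<le> nu2 N + Suc k \<and>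
      real N / 2 ^ B + 1 / 2 ^ Suc (B + m) \<le> real M / 2 ^ Q \<and>
      real M / 2 ^ Q < real N / 2 ^ B + 1 / 2 ^ (B + m)" if "z \<in> U m" for z m
    using that unfolding U_def sparse_logs_def nu2 N' by auto
  show ?case
    unfolding contains_omega_pow.simps
  proof (intro exI[of _ U] conjI allI impI ballI)
    fix m
    show "contains_omega_pow k (U m)"
      unfolding U_def by (rule Suc.IH) (simp add: N'_def)
    show "U m \<subseteq> sparse_logs (Suc k) N B"
    proof
      fix z
      assume "z \<in> U m"
      then obtain M Q where "z = - log 2 (real M / 2 ^ Q)" "nu2 M \<le> nu2 N + Suc k"
        "real N / 2 ^ B + 1 / 2 ^ Suc (B + m) \<le> real M / 2 ^ Q"
        "real M / 2 ^ Q < real N / 2 ^ B + 1 / 2 ^ (B + m)"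
        using mem by blast
      moreover have "0 < 1 / (2::real) ^ Suc (B + m)"
        by simp
      ultimately have "real N / 2 ^ B \<le> real M / 2 ^ Q" "real M / 2 ^ Q < (real N + 1) / 2 ^ B"
        using small[of m] unfolding add_divide_distrib by linarith+
      with \<open>z = _\<close> \<open>nu2 M \<le> _\<close> show "z \<in> sparse_logs (Suc k) N B"
        unfolding sparse_logs_def by blast
    qed
  next
    fix m m' :: nat and x y
    assume "m < m'" "x \<in> U m" "y \<in> U m'"
    obtain M Q where M: "x = - log 2 (real M / 2 ^ Q)"
      "real N / 2 ^ B + 1 / 2 ^ Suc (B + m) \<le> real M / 2 ^ Q"
      using mem[OF \<open>x \<in> U m\<close>] by blast
    obtain M' Q' where M': "y = - log 2 (real M' / 2 ^ Q')"
      "real N / 2 ^ B + 1 / 2 ^ Suc (B + m') \<le> real M' / 2 ^ Q'"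
      "real M' / 2 ^ Q' < real N / 2 ^ B + 1 / 2 ^ (B + m')"
      using mem[OF \<open>y \<in> U m'\<close>] by blast
    have "1 / 2 ^ (B + m') \<le> 1 / (2::real) ^ Suc (B + m)"
      using \<open>m < m'\<close> by (intro divide_left_mono power_increasing) auto
    then have "real M' / 2 ^ Q' < real M / 2 ^ Q"
      using M(2) M'(3) by linarith
    moreover have "0 < real N / 2 ^ B + 1 / 2 ^ Suc (B + m')"
      by (intro add_nonneg_pos) auto
    then have "0 < real M' / 2 ^ Q'"
      using M'(2) by linarith
    ultimately show "x < y"
      unfolding M(1) M'(1) by simp
  qed
qed

lemma defect_nonneg:
  assumes "ell_defined A n"
  shows "0 \<le> defect A n"
proof -
  obtain f where "real f * log 2 (8/7) \<le> defect A n"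
    using defect_shape[OF assms] by blast
  moreover have "0 \<le> log 2 (8/7 :: real)"
    by simp
  ultimately show ?thesis
    by (meson mult_nonneg_nonneg of_nat_0_le_iff order_trans)
qed

lemma power2_le_imp_le_ell:
  assumes "ell_defined A n" "2 ^ j \<le> n"
  shows "j \<le> ell A n"
proof -
  have "real j \<le> log 2 (real n)"
    using assms(2) by (intro le_log_of_power) (simp_all flip: of_nat_power)
  also have "\<dots> \<le> real (ell A n)"
    using defect_nonneg[OF assms(1)] by (simp add: defect_def)
  finally show ?thesis
    by simp
qed

section \<open>Consequences of admissibility\<close>

locale admissible_chains =
  fixes A
  assumes admissible: "admissible A"
begin

lemma ell_defined: "n \<ge> 1 \<Longrightarrow> ell_defined A n"
  using admissible by (simp add: admissible_def)

lemma ell_upper: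
  assumes "2 ^ a \<le> n" "n < 2 ^ Suc a"
  shows "ell A n + 1 \<le> a + nu2 n"
proof -
  have "n \<ge> 1"
    using assms(1) by (metis le_trans one_le_numeral one_le_power)
  have "\<lfloor>log 2 (real n)\<rfloor> = int a"
    using assms \<open>n \<ge> 1\<close> by (intro floor_log_nat_eq_if[of 2 a n, simplified]) auto
  then show ?thesis
    using admissible \<open>n \<ge> 1\<close> unfolding admissible_def by force
qed

lemma ell_power2_mult_le: "n \<ge> 1 \<Longrightarrow> ell A (2 ^ j * n) \<le> ell A n + j"
proof (induction j)
  case (Suc j)
  have "ell A (2 * (2 ^ j * n)) \<le> ell A (2 ^ j * n) + 1"
    using admissible Suc.prems unfolding admissible_def by simp
  then show ?case
    using Suc by (simp add: mult.assoc)
qed simp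

text \<open>Take \<open>j\<close> minimizing the natural number
  \<open>ell A (2 ^ j * M) - j\<close>. Further doublings cannot lower it, and by admissibility they
  cannot raise it. The subtraction is exact since \<open>j \<le> ell A (2 ^ j * M)\<close>.\<close>

lemma ex_stable_power2_mult:
  assumes "M \<ge> 1"
  shows "\<exists>j. stable A (2 ^ j * M)"
proof -
  let ?g = "\<lambda>j. ell A (2 ^ j * M) - j"
  obtain j where j: "\<And>i. ?g j \<le> ?g i"
    using ex_has_least_nat[of "\<lambda>_. True" 0 ?g] by blast
  have ge: "i \<le> ell A (2 ^ i * M)" for i
    using assms by (intro power2_le_imp_le_ell ell_defined) auto
  have "ell A (2 ^ i * (2 ^ j * M)) = ell A (2 ^ j * M) + i" for i
  proof (rule antisym)
    show "ell A (2 ^ i * (2 ^ j * M)) \<le> ell A (2 ^ j * M) + i"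
      using assms by (intro ell_power2_mult_le) simp
    have eq: "2 ^ i * (2 ^ j * M) = 2 ^ (i + j) * M"
      by (simp add: power_add)
    show "ell A (2 ^ j * M) + i \<le> ell A (2 ^ i * (2 ^ j * M))"
      unfolding eq using j[of "i + j"] ge[of j] ge[of "i + j"] by linarith
  qed
  then show ?thesis
    using assms by (intro exI[of _ j]) (simp add: stable_def)
qed

lemma stable_defects_subset: "stable_defects A \<subseteq> defects A"
  by (auto simp: stable_defects_def defects_def stable_def)

lemma contains_omega_pow_stable_defects:
  "contains_omega_pow k (stable_defects A \<inter> {..real k})"
proof -
  \<comment> \<open>\<open>V e\<close> collects the logarithms that become stable defects on adding
    \<open>e\<close>; \<open>v \<le> 0\<close> keeps these defects at most \<open>e\<close>.\<close>
  define V where "V e = {v \<in> sparse_logs k 1 0. v \<le> 0 \<and> real e + v \<in> stable_defects A}" for e :: nat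
  have "sparse_logs k 1 0 \<subseteq> (\<Union>e\<in>{..k}. V e)"
  proof
    fix v
    assume v: "v \<in> sparse_logs k 1 0"
    then obtain M Q where M: "v = - log 2 (real M / 2 ^ Q)" "nu2 M \<le> Suc k"
      "1 \<le> real M / 2 ^ Q" "real M / 2 ^ Q < 2"
      unfolding sparse_logs_def nu2_1 by auto
    have "real (2 ^ Q) \<le> real M" "real M < real (2 ^ Suc Q)"
      using M(3,4) by (simp_all add: field_simps)
    then have Q: "2 ^ Q \<le> M" "M < 2 ^ Suc Q"
      by (simp_all only: of_nat_le_iff of_nat_less_iff)
    then have "M \<ge> 1"
      by (metis le_trans one_le_numeral one_le_power)
    then obtain j where j: "stable A (2 ^ j * M)"
      using ex_stable_power2_mult by blast
    let ?n = "2 ^ j * M"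
    \<comment> \<open>The leading bit of \<open>?n\<close> is at position \<open>j + Q\<close>, so
      its length exceeds \<open>j + Q\<close> by an integer from 0 to \<open>k\<close>.\<close>
    have n: "2 ^ (j + Q) \<le> ?n" "?n < 2 ^ Suc (j + Q)"
      using Q by (simp_all add: power_add)
    have upper: "ell A ?n \<le> j + Q + k"
      using ell_upper[OF n] M(2) by (simp add: nu2_power2_mult)
    have lower: "j + Q \<le> ell A ?n"
      using n(1) \<open>M \<ge> 1\<close> by (intro power2_le_imp_le_ell ell_defined) auto
    have "log 2 (real ?n) = real (j + Q) + log 2 (real M / 2 ^ Q)"
      using \<open>M \<ge> 1\<close> by (simp add: log_mult log_divide log_nat_power)
    then have "real (ell A ?n - (j + Q)) + v = defect A ?n"
      using lower by (simp add: defect_def M(1) of_nat_diff)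
    then have "real (ell A ?n - (j + Q)) + v \<in> stable_defects A"
      using j by (auto simp: stable_defects_def)
    moreover have "0 \<le> log 2 (real M / 2 ^ Q)"
      using M(3) by (subst zero_le_log_cancel_iff) linarith+
    then have "v \<le> 0"
      using M(1) by simp
    ultimately have "v \<in> V (ell A ?n - (j + Q))"
      using v by (simp add: V_def)
    then show "v \<in> (\<Union>e\<in>{..k}. V e)"
      using upper by (intro UN_I[of "ell A ?n - (j + Q)"]) auto
  qed
  then have "contains_omega_pow k (\<Union>e\<in>{..k}. V e)"
    using contains_omega_pow_mono contains_omega_pow_sparse_logs[of 1 k 0] by auto
  then obtain e where e: "e \<le> k" "contains_omega_pow k (V e)"
    using contains_omega_pow_UN[of "{..k}" k V] by auto
  have "(\<lambda>v. real e + v) ` V e \<subseteq> stable_defects A \<inter> {..real k}"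
    using e(1) by (auto simp: V_def)
  then show ?thesis
    using contains_omega_pow_mono contains_omega_pow_translate[OF e(2)] by blast
qed

lemma stable_1: "stable A 1" and defect_1: "defect A 1 = 0"
proof -
  have "ell A (2 ^ j) = j" for j
  proof (rule antisym)
    have "nu2 (2 ^ j) = 1"
      using nu2_power2_mult[of j 1] nu2_1 by simp
    then show "ell A (2 ^ j) \<le> j"
      using ell_upper[of j "2 ^ j"] by simp
    show "j \<le> ell A (2 ^ j)"
      by (intro power2_le_imp_le_ell ell_defined) auto
  qed
  from this this[of 0] show "stable A 1" "defect A 1 = 0"
    by (simp_all add: stable_def defect_def)
qed

text \<open>Only a lower bound from stable defects and an upper bound from all defects enter, so one
  argument serves both sets. For \<open>k = 0\<close> the least element is the defect 0 of the
  stable number 1.\<close>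

lemma limit_value_between:
  assumes S: "stable_defects A \<subseteq> S" "S \<subseteq> defects A"
  shows "limit_value S k = real k"
proof (cases "k = 0")
  case True
  have "0 \<in> S"
    using S(1) stable_1 defect_1 by (force simp: stable_defects_def)
  moreover have "0 \<le> x" if "x \<in> S" for x
    using S(2) that defect_nonneg ell_defined by (force simp: defects_def)
  ultimately have "(LEAST x. x \<in> S) = 0"
    by (intro Least_equality) auto
  then show ?thesis
    using True by (simp add: limit_value_def)
next
  case False
  then show ?thesis
  proof (intro limit_value_eqI)
    show "contains_omega_pow k (S \<inter> {..real k})"
      using contains_omega_pow_mono[OF contains_omega_pow_stable_defects, of _ "S \<inter> {..real k}"] S(1)
      by blast
    show "type_below_omega_pow k (S \<inter> {..c})" if "c < real k" for c
      using type_below_omega_pow_subset[OF type_below_omega_pow_defects[OF ell_defined that]] S(2)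
      by blast
  qed simp
qed

lemma chain_f_eq: "chain_f A k = real k" and chain_f_st_eq: "chain_f_st A k = real k"
  unfolding chain_f_def chain_f_st_def using stable_defects_subset by (simp_all add: limit_value_between)

end

text \<open>With both functions equal to \<open>k\<close>, only this numerical comparison remains.
  The crude estimate \<open>- 2 < C_s\<close> suffices.\<close>

lemma log_C_s_less:
  assumes "34 \<le> k"
  shows "log 2 (real k + 1) - C_s < real k"
proof -
  let ?a = "\<lambda>j::nat. log 2 (1 + 2 powr (- 6 * 2 ^ j + 1))"
  have nonneg: "0 \<le> ?a j" for j
    by (subst zero_le_log_cancel_iff) (auto simp: add_pos_pos)
  \<comment> \<open>Summability is what makes \<open>suminf\<close> of nonnegative terms
    nonnegative; \<open>ln (1 + x) \<le> x\<close> provides a geometric majorant.\<close>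
  have "summable ?a"
  proof (rule summable_comparison_test')
    show "summable (\<lambda>j. 1 / ln 2 * (1/2::real) ^ j)"
      by (intro summable_mult summable_geometric) simp
    fix j :: nat
    have "real j + 1 \<le> 2 ^ j"
      using less_exp[of j] by (metis Suc_leI of_nat_Suc of_nat_le_iff of_nat_numeral of_nat_power add.commute)
    then have "- 6 * 2 ^ j + 1 \<le> - real j"
      by linarith
    then have "(2::real) powr (- 6 * 2 ^ j + 1) \<le> 2 powr (- real j)"
      by (intro powr_mono) auto
    also have "\<dots> = (1/2) ^ j"
      by (simp add: powr_minus powr_realpow power_one_over inverse_eq_divide)
    finally have "2 powr (- 6 * 2 ^ j + 1) \<le> (1/2::real) ^ j" .
    moreover have "ln (1 + 2 powr (- 6 * 2 ^ j + 1)) \<le> (2::real) powr (- 6 * 2 ^ j + 1)"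
      by (intro ln_add_one_self_le_self) simp
    ultimately have "?a j \<le> 1 / ln 2 * (1/2) ^ j"
      unfolding log_def by (simp add: divide_right_mono)
    then show "norm (?a j) \<le> 1 / ln 2 * (1/2) ^ j"
      using nonneg[of j] by simp
  qed
  then have "0 \<le> suminf ?a"
    using nonneg by (rule suminf_nonneg)
  moreover have "0 \<le> log 2 (3::real)"
    by simp
  moreover have "1 / ln 2 \<le> (2::real)"
    using ln2_ge_two_thirds by (simp add: field_simps)
  moreover have "log 2 (ln (4/3 :: real)) \<le> 0"
    using ln_le_minus_one[of "4/3 :: real"] ln_gt_zero[of "4/3 :: real"]
    by (simp add: log_le_zero_cancel_iff)
  ultimately have "- 2 < C_s"
    unfolding C_s_def by linarith
  moreover have "log 2 (real k + 1) \<le> real (k - 2)"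
  proof -
    obtain i where i: "k = i + 6"
      using assms le_Suc_ex[of 6 k] by auto
    have "i + 7 \<le> 2 ^ (i + 4)"
      by (induction i) (simp_all add: power_add)
    then have "k + 1 \<le> 2 ^ (k - 2)"
      by (simp add: i add.commute)
    then have "real k + 1 \<le> 2 ^ (k - 2)"
      by (metis of_nat_1 of_nat_add of_nat_le_iff of_nat_numeral of_nat_power)
    then have "log 2 (real k + 1) \<le> log 2 (2 ^ (k - 2))"
      by (intro log_mono) auto
    then show ?thesis
      by (simp add: log_nat_power)
  qed
  ultimately show ?thesis
    using assms by (simp add: of_nat_diff)
qed

theorem theorem7p4:
  fixes A :: "nat list set" and k :: nat
  assumes "admissible A"
  shows "(k \<le> 2 \<longrightarrow> chain_f A k = real k \<and> chain_f_st A k = real k) \<and>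
    (3 \<le> k \<and> k \<le> 7 \<longrightarrow> 2 < chain_f A k \<and> chain_f A k \<le> chain_f_st A k \<and> chain_f_st A k \<le> real k) \<and>
    (8 \<le> k \<and> k \<le> 33 \<longrightarrow> 3 < chain_f A k \<and> chain_f A k \<le> chain_f_st A k \<and> chain_f_st A k \<le> real k) \<and>
    (34 \<le> k \<longrightarrow> log 2 (real k + 1) - C_s < chain_f A k \<and> chain_f A k \<le> chain_f_st A k \<and> chain_f_st A k \<le> real k)"
proof -
  interpret admissible_chains A
    by standard (rule assms)
  show ?thesis
    using log_C_s_less[of k] by (simp add: chain_f_eq chain_f_st_eq)
qed

end
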